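(* Let $\{\mathbb{A},\mathbb{B},c\}$ be a two-person zero-sum game such that: (a1) for each $b\in\mathbb{B}$ the function $a\mapsto c(a,b)$ is lower semi-continuous on $\mathbb{A}$; (a2) there exists $b_0\in\mathbb{B}$ such that $a\mapsto c(a,b_0)$ is inf-compact on $\mathbb{A}$; and $\hat c^{\sharp}(\pi^{\mathbb A})\ge v^{\sharp}$ for all $\pi^{\mathbb A}\in\mathbb{P}^U(\mathbb{A})$. Then the game has a value $v$, that is, $v^{\flat}=v^{\sharp}=v$, and therefore $$v=\sup_{\pi^{\mathbb B}\in\mathbb{P}(\mathbb{B})}\hat c^{\flat}(\pi^{\mathbb B})=\inf_{\pi^{\mathbb A}\in\mathbb{P}(\mathbb{A})}\hat c^{\sharp}(\pi^{\mathbb A}).$$ Moreover, if $\hat c^{\sharp}(\pi^{\mathbb A})>v^{\sharp}$ for all $\pi^{\mathbb A}\in\mathbb{P}^U(\mathbb{A})$, then $\mathbb{P}^{\sharp}_{v}(\mathbb{A})\subset\mathbb{P}^S(\mathbb{A})$, the set $\mathbb{P}^{\sharp}_{v}(\mathbb{A})$ is the set of solutions for Player I, and $\mathbb{P}^{\sharp}_{v}(\mathbb{A})$ is a nonempty convex compact subset of $\mathbb{P}(\mathbb{A})$.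
   Context: For a metric space $S$, $\mathbb{P}(S)$ is the set of Borel probability measures on $S$ with the topology of weak convergence. A function $f:S\to\mathbb{R}\cup\{\pm\infty\}$ is inf-compact on $S$ if $\{s\in S: f(s)\le\lambda\}$ is compact for every $\lambda\in\mathbb{R}$. A two-person zero-sum game $\{\mathbb{A},\mathbb{B},c\}$ consists of (i) a nonempty Borel subset $\mathbb{A}$ of a Polish space; (ii) a nonempty Borel subset $\mathbb{B}$ of a Polish space; (iii) a Borel measurable payoff $c:\mathbb{A}\times\mathbb{B}\to\mathbb{R}$ (paid by Player I to Player II); such that (iv) for each $b\in\mathbb{B}$ the function $a\mapsto c(a,b)$ is bounded below on $\mathbb{A}$, and (v) for each $a\in\mathbb{A}$ the function $b\mapsto c(a,b)$ is bounded above on $\mathbb{B}$. Strategies of Players I and II are elements of $\mathbb{P}(\mathbb{A})$ and $\mathbb{P}(\mathbb{B})$; a point $a$ (or $b$) is identified with the Dirac measure at it. Let $c^+=\max\{c,0\}$, $c^-=\min\{c,0\}$ (so $c^-\le 0$), $\hat c^{\oplus}(\pi^{\mathbb A},\pi^{\mathbb B})=\int_{\mathbb A}\int_{\mathbb B}c^+(a,b)\,\pi^{\mathbb B}(db)\,\pi^{\mathbb A}(da)$ and $\hat c^{\ominus}(\pi^{\mathbb A},\pi^{\mathbb B})=\int_{\mathbb A}\int_{\mathbb B}c^-(a,b)\,\pi^{\mathbb B}(db)\,\pi^{\mathbb A}(da)$. The expected payoff $\hat c(\pi^{\mathbb A},\pi^{\mathbb B})=\hat c^{\oplus}(\pi^{\mathbb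 A},\pi^{\mathbb B})+\hat c^{\ominus}(\pi^{\mathbb A},\pi^{\mathbb B})$ is well-defined if $\hat c^{\oplus}(\pi^{\mathbb A},\pi^{\mathbb B})<+\infty$ or $\hat c^{\ominus}(\pi^{\mathbb A},\pi^{\mathbb B})>-\infty$, and undefined otherwise. By (iv),(v) it is well-defined whenever one of the strategies is a Dirac measure. $\mathbb{P}^S(\mathbb{A})$ (sensible strategies) is the set of $\pi^{\mathbb A}\in\mathbb{P}(\mathbb{A})$ such that $\hat c(\pi^{\mathbb A},\pi^{\mathbb B})$ is well-defined for every $\pi^{\mathbb B}\in\mathbb{P}(\mathbb{B})$, and $\mathbb{P}^U(\mathbb{A})=\mathbb{P}(\mathbb{A})\setminus\mathbb{P}^S(\mathbb{A})$; $\mathbb{P}^S(\mathbb{B})$ is defined symmetrically. $\hat c^{\flat}(\pi^{\mathbb B})=\inf_{a\in\mathbb{A}}\hat c(a,\pi^{\mathbb B})$, $\hat c^{\sharp}(\pi^{\mathbb A})=\sup_{b\in\mathbb{B}}\hat c(\pi^{\mathbb A},b)$; $v^{\flat}=\sup_{\pi^{\mathbb B}\in\mathbb{P}^S(\mathbb{B})}\hat c^{\flat}(\pi^{\mathbb B})$, $v^{\sharp}=\inf_{\pi^{\mathbb A}\in\mathbb{P}^S(\mathbb{A})}\hat c^{\sharp}(\pi^{\mathbb A})$. The game has a value $v$ if $v^{\flat}=v^{\sharp}$, and then $v$ is this common quantity. For an extended real $\alpha$, $\mathbb{P}^{\sharp}_{\alpha}(\mathbb{A})=\{\pi^{\mathbb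 A}\in\mathbb{P}(\mathbb{A}):\hat c^{\sharp}(\pi^{\mathbb A})\le\alpha\}$. A solution for Player I is a strategy $\pi^{\mathbb A}\in\mathbb{P}^S(\mathbb{A})$ with $\hat c^{\sharp}(\pi^{\mathbb A})=v^{\sharp}$. *)

theory Defs
  imports "HOL-Probability.Probability"
begin

section \<open>Borel probability measures on a subset of a topological space\<close>

text \<open>\<open>space (prob_algebra M)\<close> is the set of all probability measures whose
  \<open>\<sigma>\<close>-algebra is that of \<open>M\<close>; only this set is used, not its \<open>\<sigma>\<close>-algebra.\<close>

definition borel_probs :: "'a::topological_space set \<Rightarrow> 'a measure set" where
  "borel_probs S = space (prob_algebra (restrict_space borel S))"

text \<open>The coarsest topology that makes \<open>\<mu> \<mapsto> \<integral>f d\<mu>\<close> continuous for every bounded continuous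
  \<open>f : S \<rightarrow> \<real>\<close>. Taking \<open>f = 0\<close> and \<open>U = UNIV\<close> shows that its carrier is all of
  \<open>borel_probs S\<close>.\<close>

definition weak_topology :: "'a::topological_space set \<Rightarrow> 'a measure topology" where
  "weak_topology S = topology_generated_by
     {{\<mu> \<in> borel_probs S. (\<integral>x. f x \<partial>\<mu>) \<in> U} | (f :: 'a \<Rightarrow> real) U.
        continuous_on S f \<and> bounded (f ` S) \<and> open U}"

lemma topspace_weak_topology: "topspace (weak_topology S) = borel_probs S"
proof -
  have "borel_probs S \<in> {{\<mu> \<in> borel_probs S. (\<integral>x. f x \<partial>\<mu>) \<in> U} | (f :: 'a \<Rightarrow> real) U.
        continuous_on S f \<and> bounded (f ` S) \<and> open U}"
    by (rule CollectI, rule exI[of _ "\<lambda>_. 0"], rule exI[of _ UNIV])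
      (auto intro: bounded_subset[of "{0}"])
  then show ?thesis
    unfolding weak_topology_def topology_generated_by_topspace by blast
qed

definition dirac_on :: "'a::topological_space set \<Rightarrow> 'a \<Rightarrow> 'a measure" where
  "dirac_on S x = return (restrict_space borel S) x"

text \<open>The library has no linear structure on measures, hence the following two notions.\<close>

definition mixture :: "real \<Rightarrow> 'a measure \<Rightarrow> 'a measure \<Rightarrow> 'a measure" where
  "mixture t \<mu> \<nu> = measure_of (space \<mu>) (sets \<mu>)
     (\<lambda>X. ennreal t * emeasure \<mu> X + ennreal (1 - t) * emeasure \<nu> X)"

definition convex_measures :: "'a measure set \<Rightarrow> bool" where
  "convex_measures K \<longleftrightarrow> (\<forall>\<mu>\<in>K. \<forall>\<nu>\<in>K. \<forall>t\<in>{0..1}. mixture t \<mu> \<nu> \<in> K)"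

lemma sets_mixture: "sets (mixture t \<mu> \<nu>) = sets \<mu>"
  unfolding mixture_def by (simp add: sets.space_closed)

lemma emeasure_mixture:
  assumes "sets \<nu> = sets \<mu>" and "X \<in> sets \<mu>"
  shows "emeasure (mixture t \<mu> \<nu>) X = ennreal t * emeasure \<mu> X + ennreal (1 - t) * emeasure \<nu> X"
proof (rule emeasure_measure_of[OF mixture_def])
  show "countably_additive (sets (mixture t \<mu> \<nu>))
     (\<lambda>X. ennreal t * emeasure \<mu> X + ennreal (1 - t) * emeasure \<nu> X)"
    unfolding countably_additive_def sets_mixture
  proof (intro allI impI)
    fix F :: "nat \<Rightarrow> 'a set"
    assume F: "range F \<subseteq> sets \<mu>" "disjoint_family F"
    have "(\<Sum>i. ennreal t * emeasure \<mu> (F i) + ennreal (1 - t) * emeasure \<nu> (F i))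
        = (\<Sum>i. ennreal t * emeasure \<mu> (F i)) + (\<Sum>i. ennreal (1 - t) * emeasure \<nu> (F i))"
      by (rule suminf_add[symmetric]) auto
    also have "\<dots> = ennreal t * emeasure \<mu> (\<Union>i. F i) + ennreal (1 - t) * emeasure \<nu> (\<Union>i. F i)"
      using F assms(1) by (simp add: ennreal_suminf_cmult suminf_emeasure)
    finally show "(\<Sum>i. ennreal t * emeasure \<mu> (F i) + ennreal (1 - t) * emeasure \<nu> (F i))
        = ennreal t * emeasure \<mu> (\<Union>i. F i) + ennreal (1 - t) * emeasure \<nu> (\<Union>i. F i)" .
  qed
qed (use assms sets.space_closed in \<open>auto simp: positive_def sets_mixture\<close>)

lemma convex_borel_probs: "convex_measures (borel_probs S)"
  unfolding convex_measures_def
proof (intro ballI)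
  fix \<mu> \<nu> :: "'a measure" and t :: real
  assume \<mu>: "\<mu> \<in> borel_probs S" and \<nu>: "\<nu> \<in> borel_probs S" and t: "t \<in> {0..1}"
  have sets_eq: "sets \<nu> = sets \<mu>"
    and sets_\<mu>: "sets \<mu> = sets (restrict_space borel S)"
    using \<mu> \<nu> by (auto simp: borel_probs_def space_prob_algebra)
  have prob: "prob_space \<mu>" "prob_space \<nu>"
    using \<mu> \<nu> by (auto simp: borel_probs_def space_prob_algebra)
  have space_eq: "space (mixture t \<mu> \<nu>) = space \<mu>" "space \<nu> = space \<mu>"
    using sets_eq_imp_space_eq[OF sets_mixture[of t \<mu> \<nu>]] sets_eq_imp_space_eq[OF sets_eq]
    by auto
  have "emeasure \<mu> (space \<mu>) = 1" "emeasure \<nu> (space \<mu>) = 1"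
    using prob_space.emeasure_space_1[OF prob(1)] prob_space.emeasure_space_1[OF prob(2)]
    by (simp_all add: space_eq)
  then have "emeasure (mixture t \<mu> \<nu>) (space \<mu>) = ennreal t + ennreal (1 - t)"
    using emeasure_mixture[OF sets_eq sets.top, of t] by simp
  also have "\<dots> = 1"
    using t by (subst ennreal_plus[symmetric]) auto
  finally have "prob_space (mixture t \<mu> \<nu>)"
    by (intro prob_spaceI) (simp add: space_eq)
  then show "mixture t \<mu> \<nu> \<in> borel_probs S"
    by (simp add: borel_probs_def space_prob_algebra sets_mixture sets_\<mu>)
qed

section \<open>Semicontinuity and inf-compactness\<close>

text \<open>The filter \<open>at x within S\<close> is punctured, which is harmless for this inequality. At an
  isolated point of \<open>S\<close> it is trivial, so that \<open>Liminf\<close> is \<open>\<infinity>\<close> and the condition holds.\<close>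

definition lower_semicontinuous_on :: "'a::topological_space set \<Rightarrow> ('a \<Rightarrow> ereal) \<Rightarrow> bool" where
  "lower_semicontinuous_on S f \<longleftrightarrow> (\<forall>x\<in>S. f x \<le> Liminf (at x within S) f)"

definition inf_compact_on :: "'a::topological_space set \<Rightarrow> ('a \<Rightarrow> ereal) \<Rightarrow> bool" where
  "inf_compact_on S f \<longleftrightarrow> (\<forall>l::real. compact {x \<in> S. f x \<le> ereal l})"

section \<open>Two-person zero-sum games\<close>

locale zero_sum_game =
  fixes A :: "'a::polish_space set" and B :: "'b::polish_space set"
    and c :: "'a \<Rightarrow> 'b \<Rightarrow> real"
  assumes A_nonempty: "A \<noteq> {}" and A_borel: "A \<in> sets borel"
    and B_nonempty: "B \<noteq> {}" and B_borel: "B \<in> sets borel"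
    and payoff_measurable:
      "(\<lambda>(a, b). c a b) \<in> borel_measurable (restrict_space borel (A \<times> B))"
    and payoff_bdd_below: "b \<in> B \<Longrightarrow> bdd_below ((\<lambda>a. c a b) ` A)"
    and payoff_bdd_above: "a \<in> A \<Longrightarrow> bdd_above ((\<lambda>b. c a b) ` B)"

definition payoff_pos :: "('a \<Rightarrow> 'b \<Rightarrow> real) \<Rightarrow> 'a measure \<Rightarrow> 'b measure \<Rightarrow> ereal" where
  "payoff_pos c \<pi>A \<pi>B = enn2ereal (\<integral>\<^sup>+ a. (\<integral>\<^sup>+ b. ennreal (max (c a b) 0) \<partial>\<pi>B) \<partial>\<pi>A)"

definition payoff_neg :: "('a \<Rightarrow> 'b \<Rightarrow> real) \<Rightarrow> 'a measure \<Rightarrow> 'b measure \<Rightarrow> ereal" where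
  "payoff_neg c \<pi>A \<pi>B = - enn2ereal (\<integral>\<^sup>+ a. (\<integral>\<^sup>+ b. ennreal (- min (c a b) 0) \<partial>\<pi>B) \<partial>\<pi>A)"

definition payoff_defined :: "('a \<Rightarrow> 'b \<Rightarrow> real) \<Rightarrow> 'a measure \<Rightarrow> 'b measure \<Rightarrow> bool" where
  "payoff_defined c \<pi>A \<pi>B \<longleftrightarrow> payoff_pos c \<pi>A \<pi>B < \<infinity> \<or> payoff_neg c \<pi>A \<pi>B > - \<infinity>"

text \<open>Meaningful only if \<open>payoff_defined c \<pi>A \<pi>B\<close> holds: \<open>\<infinity> + - \<infinity> = \<infinity>\<close> in \<^typ>\<open>ereal\<close>. Below it is
  only evaluated with one of the two strategies a Dirac measure, where it is always defined
  in a game.\<close>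

definition expected_payoff :: "('a \<Rightarrow> 'b \<Rightarrow> real) \<Rightarrow> 'a measure \<Rightarrow> 'b measure \<Rightarrow> ereal" where
  "expected_payoff c \<pi>A \<pi>B = payoff_pos c \<pi>A \<pi>B + payoff_neg c \<pi>A \<pi>B"

definition sensible_I ::
  "'a::topological_space set \<Rightarrow> 'b::topological_space set \<Rightarrow> ('a \<Rightarrow> 'b \<Rightarrow> real) \<Rightarrow> 'a measure set" where
  "sensible_I A B c = {\<pi>A \<in> borel_probs A. \<forall>\<pi>B \<in> borel_probs B. payoff_defined c \<pi>A \<pi>B}"

definition sensible_II ::
  "'a::topological_space set \<Rightarrow> 'b::topological_space set \<Rightarrow> ('a \<Rightarrow> 'b \<Rightarrow> real) \<Rightarrow> 'b measure set" where
  "sensible_II A B c = {\<pi>B \<in> borel_probs B. \<forall>\<pi>A \<in> borel_probs A. payoff_defined c \<pi>A \<pi>B}"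

definition unsensible_I ::
  "'a::topological_space set \<Rightarrow> 'b::topological_space set \<Rightarrow> ('a \<Rightarrow> 'b \<Rightarrow> real) \<Rightarrow> 'a measure set" where
  "unsensible_I A B c = borel_probs A - sensible_I A B c"

definition payoff_flat ::
  "'a::topological_space set \<Rightarrow> ('a \<Rightarrow> 'b \<Rightarrow> real) \<Rightarrow> 'b measure \<Rightarrow> ereal" where
  "payoff_flat A c \<pi>B = (INF a\<in>A. expected_payoff c (dirac_on A a) \<pi>B)"

definition payoff_sharp ::
  "'b::topological_space set \<Rightarrow> ('a \<Rightarrow> 'b \<Rightarrow> real) \<Rightarrow> 'a measure \<Rightarrow> ereal" where
  "payoff_sharp B c \<pi>A = (SUP b\<in>B. expected_payoff c \<pi>A (dirac_on B b))"

definition value_flat ::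
  "'a::topological_space set \<Rightarrow> 'b::topological_space set \<Rightarrow> ('a \<Rightarrow> 'b \<Rightarrow> real) \<Rightarrow> ereal" where
  "value_flat A B c = (SUP \<pi>B \<in> sensible_II A B c. payoff_flat A c \<pi>B)"

definition value_sharp ::
  "'a::topological_space set \<Rightarrow> 'b::topological_space set \<Rightarrow> ('a \<Rightarrow> 'b \<Rightarrow> real) \<Rightarrow> ereal" where
  "value_sharp A B c = (INF \<pi>A \<in> sensible_I A B c. payoff_sharp B c \<pi>A)"

definition has_game_value ::
  "'a::topological_space set \<Rightarrow> 'b::topological_space set \<Rightarrow> ('a \<Rightarrow> 'b \<Rightarrow> real) \<Rightarrow> ereal \<Rightarrow> bool" where
  "has_game_value A B c v \<longleftrightarrow> value_flat A B c = v \<and> value_sharp A B c = v"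

definition sharp_sublevel ::
  "'a::topological_space set \<Rightarrow> 'b::topological_space set \<Rightarrow> ('a \<Rightarrow> 'b \<Rightarrow> real) \<Rightarrow> ereal \<Rightarrow> 'a measure set" where
  "sharp_sublevel A B c \<alpha> = {\<pi>A \<in> borel_probs A. payoff_sharp B c \<pi>A \<le> \<alpha>}"

definition solutions_I ::
  "'a::topological_space set \<Rightarrow> 'b::topological_space set \<Rightarrow> ('a \<Rightarrow> 'b \<Rightarrow> real) \<Rightarrow> 'a measure set" where
  "solutions_I A B c = {\<pi>A \<in> sensible_I A B c. payoff_sharp B c \<pi>A = value_sharp A B c}"

end

theory Submission
  imports Defs
begin

text \<open>The lower value \<open>v\<^sup>\<flat>\<close> never exceeds the upper value \<open>v\<^sup>\<sharp>\<close>: for a sensible \<open>\<pi>\<^sup>A\<close> the double integral of the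
payoff may be computed in either order (\<open>payoff_flat_le_payoff_sharp\<close>). For the converse it is enough
to find \<^emph>\<open>some\<close> strategy \<open>\<pi>\<close> of Player I, sensible or not, whose expected payoff against every \<open>b\<close> is at
most \<open>v\<^sup>\<flat>\<close>, because the hypothesis on the other strategies gives \<open>v\<^sup>\<sharp> \<le> c\<^sup>\<sharp>(\<pi>)\<close> for all of them.

Fix a real \<open>t > v\<^sup>\<flat>\<close>. Against finitely many points \<open>b\<close> a strategy that pays at most \<open>t\<close> exists by a finite
minimax theorem (\<open>finite_minimax_convexlike\<close>): otherwise some convex combination of these points
would guarantee \<open>t\<close> to Player II, and it is a sensible strategy because each \<open>c(\<cdot>, b)\<close> is bounded below
(\<open>strategy_against_finitely_many\<close>). The sets
\<open>{\<pi>. c(\<pi>, b) \<le> t}\<close> with \<open>b \<in> B\<close> and \<open>t > v\<^sup>\<flat>\<close> thus have the finite intersection property, and a common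
point of all of them is the desired strategy (\<open>strategy_within_value_flat\<close>).

A common point exists by compactness. A bound on \<open>c(\<cdot>, b\<^sub>0)\<close> makes strategies tight, since the sublevel
sets of this function are compact (\<open>coercive_bound_imp_cluster_point\<close>), and tight families have
cluster points (\<open>tight_filter_has_cluster_point\<close>). This half of Prokhorov's theorem is proved
here for filters. By Tychonoff's theorem a filter of probability measures has a refinement
that converges on every set; the limit is only finitely additive, but its values on
compact sets form a content, from which Caratheodory's construction makes a measure
(\<open>content_extends_to_borel_measure\<close>). Tightness says that no mass is lost. The resulting
measure satisfies the portmanteau inequality on open sets, hence integrals of lower semicontinuous
functions can only drop in the limit (\<open>extended_integral_le_on_limit\<close>) and those of bounded
continuous functions converge (\<open>liminf_on_opens_imp_weak_limit\<close>).

The same cluster point argument, applied to families of weakly closed sets, shows that the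
sublevel sets of \<open>c\<^sup>\<sharp>\<close> are compact (\<open>sharp_sublevel_compact\<close>). They are convex because the expected payoff is
affine in the strategy.\<close>

section \<open>Minimax for finitely many functions\<close>

text \<open>The region above the image of \<open>(g, h)\<close> in the plane is convex and misses the open quadrant below
\<open>(t, t)\<close>. A line that separates the two has a normal vector with nonnegative entries, whose
normalisation is the convex combination.\<close>

lemma two_function_minimax:
  fixes g h :: "'x \<Rightarrow> real"
  assumes convexlike: "\<And>x y u. \<lbrakk>x \<in> X; y \<in> X; 0 \<le> u; u \<le> 1\<rbrakk> \<Longrightarrow>
      \<exists>z\<in>X. g z \<le> u * g x + (1 - u) * g y \<and> h z \<le> u * h x + (1 - u) * h y"
    and cover: "\<And>x. x \<in> X \<Longrightarrow> t \<le> g x \<or> t \<le> h x"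
  shows "\<exists>u. 0 \<le> u \<and> u \<le> 1 \<and> (\<forall>x\<in>X. t \<le> u * g x + (1 - u) * h x)"
proof (cases "X = {}")
  case True
  then show ?thesis by (intro exI[of _ 0]) auto
next
  case False
  define D where "D = {z::real \<times> real. \<exists>x\<in>X. g x \<le> fst z \<and> h x \<le> snd z}"
  define Q where "Q = {z::real \<times> real. fst z < t \<and> snd z < t}"
  have "convex D"
    unfolding convex_alt
  proof (intro ballI allI impI)
    fix z w :: "real \<times> real" and u :: real
    assume z: "z \<in> D" and w: "w \<in> D" and u: "0 \<le> u \<and> u \<le> 1"
    obtain x where x: "x \<in> X" "g x \<le> fst z" "h x \<le> snd z" using z by (auto simp: D_def)
    obtain y where y: "y \<in> X" "g y \<le> fst w" "h y \<le> snd w" using w by (auto simp: D_def)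
    obtain q where q: "q \<in> X" "g q \<le> (1-u) * g x + (1 - (1-u)) * g y"
        "h q \<le> (1-u) * h x + (1 - (1-u)) * h y"
      using convexlike[of x y "1-u"] x(1) y(1) u by auto
    have "(1-u) * g x \<le> (1-u) * fst z" "u * g y \<le> u * fst w"
         "(1-u) * h x \<le> (1-u) * snd z" "u * h y \<le> u * snd w"
      using x y u by (auto intro!: mult_left_mono)
    then show "(1 - u) *\<^sub>R z + u *\<^sub>R w \<in> D"
      using q unfolding D_def by (auto intro!: bexI[of _ q])
  qed
  moreover have "convex Q"
  proof -
    have eq: "Q = {..<t} \<times> {..<t}" by (auto simp: Q_def)
    show ?thesis unfolding eq by (intro convex_Times convex_real_interval)
  qed
  moreover have "D \<noteq> {}" using False unfolding D_def by auto
  moreover have "Q \<noteq> {}" unfolding Q_def by (auto intro!: exI[of _ "t-1"])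
  moreover have "Q \<inter> D = {}"
    using cover unfolding Q_def D_def by force
  ultimately obtain n :: "real \<times> real" and \<beta> where n: "n \<noteq> 0" and
    Qb: "\<And>z. z \<in> Q \<Longrightarrow> n \<bullet> z \<le> \<beta>" and Db: "\<And>z. z \<in> D \<Longrightarrow> n \<bullet> z \<ge> \<beta>"
    using separating_hyperplane_sets[of Q D] by blast
  obtain p q where pq: "n = (p, q)" by (cases n)
  obtain x0 where x0: "x0 \<in> X" using False by auto
  \<comment> \<open>\<open>D\<close> is upward closed, so its supporting functional has nonnegative coefficients.\<close>
  have p0: "p \<ge> 0"
  proof (rule ccontr)
    assume neg: "\<not> p \<ge> 0"
    define s where "s = \<bar>\<beta> - p * g x0 - q * h x0\<bar> + 1"
    have "s / (-p) \<ge> 0" using neg by (intro divide_nonneg_pos) (auto simp: s_def)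
    then have "(g x0 + s / (-p), h x0) \<in> D" using x0 by (auto simp: D_def intro!: bexI[of _ x0])
    from Db[OF this] have "\<beta> \<le> p * g x0 - s + q * h x0"
      using neg by (simp add: pq algebra_simps)
    then show False by (simp add: s_def)
  qed
  have q0: "q \<ge> 0"
  proof (rule ccontr)
    assume neg: "\<not> q \<ge> 0"
    define s where "s = \<bar>\<beta> - p * g x0 - q * h x0\<bar> + 1"
    have "s / (-q) \<ge> 0" using neg by (intro divide_nonneg_pos) (auto simp: s_def)
    then have "(g x0, h x0 + s / (-q)) \<in> D" using x0 by (auto simp: D_def intro!: bexI[of _ x0])
    from Db[OF this] have "\<beta> \<le> p * g x0 - s + q * h x0"
      using neg by (simp add: pq algebra_simps)
    then show False by (simp add: s_def)
  qed
  have pq0: "p + q > 0" using p0 q0 n pq by (auto simp: zero_prod_def)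
  have "(p + q) * t \<le> \<beta>"
  proof (rule field_le_epsilon)
    fix e :: real assume e: "0 < e"
    define d where "d = e / (p + q)"
    have "(t - d, t - d) \<in> Q" using e pq0 by (auto simp: Q_def d_def)
    from Qb[OF this] have "(p + q) * t - (p + q) * d \<le> \<beta>" by (simp add: pq algebra_simps)
    moreover have "(p + q) * d = e" using pq0 by (simp add: d_def)
    ultimately show "(p + q) * t \<le> \<beta> + e" by simp
  qed
  moreover have "\<beta> \<le> p * g x + q * h x" if "x \<in> X" for x
    using Db[of "(g x, h x)"] that by (auto simp: D_def pq)
  ultimately have ineq: "(p + q) * t \<le> p * g x + q * h x" if "x \<in> X" for x
    using that by force
  define u where "u = p / (p + q)"
  have u: "1 - u = q / (p + q)" using pq0 by (simp add: u_def field_simps)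
  have "t \<le> u * g x + (1 - u) * h x" if "x \<in> X" for x
  proof -
    have "t \<le> (p * g x + q * h x) / (p + q)"
      using ineq[OF that] pq0 by (simp add: pos_le_divide_eq mult.commute)
    also have "\<dots> = u * g x + (1 - u) * h x" unfolding u by (simp add: u_def add_divide_distrib)
    finally show ?thesis .
  qed
  moreover have "0 \<le> u" "u \<le> 1" using p0 q0 pq0 by (auto simp: u_def)
  ultimately show ?thesis by blast
qed

text \<open>A finite form of Ky Fan's minimax theorem. Induction on \<open>I\<close> keeps all convexity in the plane and so needs
no Euclidean space of dimension \<open>card I\<close>: on the part of \<open>X\<close> where the new function is
below \<open>t\<close> the others still cover, which gives a convex combination of them; this combination and the
new function form the pair to which the planar case applies.\<close>

lemma finite_minimax_convexlike:
  fixes f :: "'i \<Rightarrow> 'x \<Rightarrow> real"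
  assumes "finite I" "I \<noteq> {}"
    and convexlike: "\<And>x y u. \<lbrakk>x \<in> X; y \<in> X; 0 \<le> u; u \<le> 1\<rbrakk> \<Longrightarrow>
      \<exists>z\<in>X. \<forall>i\<in>I. f i z \<le> u * f i x + (1 - u) * f i y"
    and cover: "\<And>x. x \<in> X \<Longrightarrow> \<exists>i\<in>I. t \<le> f i x"
  shows "\<exists>p. (\<forall>i\<in>I. 0 \<le> p i) \<and> sum p I = 1 \<and> (\<forall>x\<in>X. t \<le> (\<Sum>i\<in>I. p i * f i x))"
  using assms
proof (induction I arbitrary: X rule: finite_ne_induct)
  case (singleton j)
  then show ?case by (intro exI[of _ "\<lambda>_. 1"]) auto
next
  case (insert j I)
  note cvx = insert.prems(1) and cov = insert.prems(2)
  define X' where "X' = {x \<in> X. f j x < t}"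
  have "\<exists>z\<in>X'. \<forall>i\<in>I. f i z \<le> u * f i x + (1 - u) * f i y"
    if xy: "x \<in> X'" "y \<in> X'" and u: "0 \<le> u" "u \<le> 1" for x y u
  proof -
    obtain z where z: "z \<in> X" "\<forall>i\<in>insert j I. f i z \<le> u * f i x + (1 - u) * f i y"
      using cvx[of x y u] xy u by (auto simp: X'_def)
    have "u * f j x + (1 - u) * f j y < t"
      using xy u unfolding X'_def by (intro convex_bound_lt) auto
    then have "f j z < t" using z(2) by (metis insertI1 order_le_less_trans)
    then show ?thesis using z by (auto simp: X'_def)
  qed
  moreover have "\<exists>i\<in>I. t \<le> f i x" if "x \<in> X'" for x
    using cov[of x] that by (auto simp: X'_def)
  ultimately obtain p where p: "\<forall>i\<in>I. 0 \<le> p i" "sum p I = 1"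
      "\<forall>x\<in>X'. t \<le> (\<Sum>i\<in>I. p i * f i x)"
    using insert.IH[of X'] by blast
  define g where "g x = (\<Sum>i\<in>I. p i * f i x)" for x
  have "\<exists>u. 0 \<le> u \<and> u \<le> 1 \<and> (\<forall>x\<in>X. t \<le> u * g x + (1 - u) * f j x)"
  proof (rule two_function_minimax)
    fix x y u assume xy: "x \<in> X" "y \<in> X" and u: "0 \<le> u" "u \<le> (1::real)"
    then obtain z where z: "z \<in> X" "\<forall>i\<in>insert j I. f i z \<le> u * f i x + (1 - u) * f i y"
      using cvx[of x y u] by auto
    have "g z \<le> (\<Sum>i\<in>I. p i * (u * f i x + (1 - u) * f i y))"
      unfolding g_def using p z by (intro sum_mono mult_left_mono) auto
    also have "\<dots> = u * g x + (1 - u) * g y"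
      by (simp add: g_def sum_distrib_left sum.distrib[symmetric] algebra_simps)
    finally show "\<exists>z\<in>X. g z \<le> u * g x + (1 - u) * g y \<and> f j z \<le> u * f j x + (1 - u) * f j y"
      using z by auto
  next
    fix x assume "x \<in> X"
    then show "t \<le> g x \<or> t \<le> f j x" using p(3) by (auto simp: X'_def g_def)
  qed
  then obtain u where u: "0 \<le> u" "u \<le> 1" "\<forall>x\<in>X. t \<le> u * g x + (1 - u) * f j x" by blast
  define p' where "p' i = (if i = j then 1 - u else u * p i)" for i
  have [simp]: "p' j = 1 - u" by (simp add: p'_def)
  have p'I: "p' i = u * p i" if "i \<in> I" for i using that insert.hyps by (auto simp: p'_def)
  have "sum p' I = u" using p(2) by (simp add: p'I sum_distrib_left[symmetric])
  moreover have "(\<Sum>i\<in>I. p' i * f i x) = u * g x" for x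
    by (simp add: p'I g_def sum_distrib_left mult.assoc)
  ultimately show ?case
    using insert.hyps p(1) u by (intro exI[of _ p']) (auto simp: p'I add.commute)
qed

section \<open>Borel measures from contents on compact sets\<close>

lemma compact_cover_two_split:
  fixes K :: "'a::t4_space set"
  assumes "compact K" "open U" "open V" "K \<subseteq> U \<union> V"
  obtains L M where "compact L" "compact M" "K = L \<union> M" "L \<subseteq> U" "M \<subseteq> V"
proof -
  have "closed K" using assms(1) by (rule compact_imp_closed)
  then have "closed (K - U)" "closed (K - V)" "(K - U) \<inter> (K - V) = {}"
    using assms by auto
  then obtain O1 O2 where O: "open O1" "open O2" "K - U \<subseteq> O1" "K - V \<subseteq> O2" "O1 \<inter> O2 = {}"
    using t4_space by meson
  show ?thesis
  proof (rule that[of "K - O1" "K - O2"])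
    show "compact (K - O1)" "compact (K - O2)"
      using assms(1) O(1,2) by (auto intro: compact_diff)
  qed (use O in auto)
qed

text \<open>A content in the sense of Halmos: superadditivity on disjoint sets and subadditivity together express
additivity.\<close>

locale compact_content =
  fixes m :: "'a::t4_space set \<Rightarrow> ennreal"
  assumes content_mono: "\<lbrakk>compact K; compact L; K \<subseteq> L\<rbrakk> \<Longrightarrow> m K \<le> m L"
    and content_subadd: "\<lbrakk>compact K; compact L\<rbrakk> \<Longrightarrow> m (K \<union> L) \<le> m K + m L"
    and content_disjoint: "\<lbrakk>compact K; compact L; K \<inter> L = {}\<rbrakk> \<Longrightarrow> m K + m L \<le> m (K \<union> L)"
    and content_finite: "compact K \<Longrightarrow> m K < \<infinity>"
begin

lemma content_empty: "m {} = 0"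
proof -
  have "m {} + m {} \<le> m {}" using content_disjoint[of "{}" "{}"] by simp
  moreover have "m {} < top" using content_finite[of "{}"] by simp
  ultimately show ?thesis
    using ennreal_add_left_cancel_le[of "m {}" "m {}" 0] by auto
qed

text \<open>Countable subadditivity, which \<open>m\<close> itself need not have, comes from compactness: a compact subset
of a union of open sets is covered by finitely many of them and splits into compact pieces.\<close>

definition inner_content :: "'a set \<Rightarrow> ennreal" where
  "inner_content U = (SUP K\<in>{K. compact K \<and> K \<subseteq> U}. m K)"

lemma content_le_inner: "\<lbrakk>compact K; K \<subseteq> U\<rbrakk> \<Longrightarrow> m K \<le> inner_content U"
  unfolding inner_content_def by (rule SUP_upper) auto

lemma inner_content_le: "(\<And>K. \<lbrakk>compact K; K \<subseteq> U\<rbrakk> \<Longrightarrow> m K \<le> x) \<Longrightarrow> inner_content U \<le> x"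
  unfolding inner_content_def by (rule SUP_least) auto

lemma inner_content_mono: "U \<subseteq> V \<Longrightarrow> inner_content U \<le> inner_content V"
  by (rule inner_content_le) (auto intro: content_le_inner)

lemma content_le_sum_inner:
  assumes "finite N" "\<And>i. i \<in> N \<Longrightarrow> open (U i)" "compact K" "K \<subseteq> (\<Union>i\<in>N. U i)"
  shows "m K \<le> (\<Sum>i\<in>N. inner_content (U i))"
  using assms
proof (induction N arbitrary: K rule: finite_induct)
  case empty
  then show ?case by (simp add: content_empty)
next
  case (insert j N)
  obtain L M where LM: "compact L" "compact M" "K = L \<union> M" "L \<subseteq> U j" "M \<subseteq> (\<Union>i\<in>N. U i)"
    using compact_cover_two_split[of K "U j" "\<Union>i\<in>N. U i"] insert.prems by (auto simp: open_UN)
  have "m K \<le> m L + m M" using LM content_subadd by simp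
  also have "\<dots> \<le> inner_content (U j) + (\<Sum>i\<in>N. inner_content (U i))"
    using LM insert by (intro add_mono content_le_inner) auto
  finally show ?case using insert.hyps by simp
qed

lemma inner_content_countably_subadditive:
  fixes U :: "nat \<Rightarrow> 'a set"
  assumes "\<And>i. open (U i)"
  shows "inner_content (\<Union>i. U i) \<le> (\<Sum>i. inner_content (U i))"
proof (rule inner_content_le)
  fix K assume K: "compact K" "K \<subseteq> (\<Union>i. U i)"
  then obtain N where N: "finite N" "K \<subseteq> (\<Union>i\<in>N. U i)"
    using compactE_image[of K UNIV U] assms by (metis UNIV_I)
  then have "m K \<le> (\<Sum>i\<in>N. inner_content (U i))"
    using content_le_sum_inner[of N U K] assms K by auto
  also have "\<dots> \<le> (\<Sum>i. inner_content (U i))"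
    using N by (intro sum_le_suminf) auto
  finally show "m K \<le> (\<Sum>i. inner_content (U i))" .
qed

definition outer_content :: "'a set \<Rightarrow> ennreal" where
  "outer_content E = (INF U\<in>{U. open U \<and> E \<subseteq> U}. inner_content U)"

lemma outer_content_le: "\<lbrakk>open U; E \<subseteq> U\<rbrakk> \<Longrightarrow> outer_content E \<le> inner_content U"
  unfolding outer_content_def by (rule INF_lower) auto

lemma outer_content_ge: "(\<And>U. \<lbrakk>open U; E \<subseteq> U\<rbrakk> \<Longrightarrow> x \<le> inner_content U) \<Longrightarrow> x \<le> outer_content E"
  unfolding outer_content_def by (rule INF_greatest) auto

lemma outer_content_open: "open U \<Longrightarrow> outer_content U = inner_content U"
  by (intro antisym outer_content_le outer_content_ge inner_content_mono) auto

lemma content_le_outer: "compact K \<Longrightarrow> m K \<le> outer_content K"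
  by (intro outer_content_ge content_le_inner) auto

lemma outer_content_outer_measure: "outer_measure_space UNIV outer_content"
  unfolding outer_measure_space_def
proof (intro conjI)
  have "outer_content {} \<le> inner_content {}" by (rule outer_content_le) auto
  also have "\<dots> \<le> 0" by (rule inner_content_le) (auto simp: content_empty)
  finally show "positive UNIV outer_content" by (simp add: positive_def)
  show "increasing UNIV outer_content"
    unfolding increasing_def by (auto intro!: outer_content_ge outer_content_le)
  show "countably_subadditive UNIV outer_content"
    unfolding countably_subadditive_def
  proof (intro allI impI)
    fix E :: "nat \<Rightarrow> 'a set"
    show "outer_content (\<Union>i. E i) \<le> (\<Sum>i. outer_content (E i))"
    proof (rule ennreal_le_epsilon)
      fix e :: real
      assume fin: "(\<Sum>i. outer_content (E i)) < top" and e: "0 < e"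
      have "\<exists>U. open U \<and> E i \<subseteq> U \<and> inner_content U \<le> outer_content (E i) + ennreal (e * (1/2) ^ Suc i)" for i
      proof -
        have "outer_content (E i) \<le> (\<Sum>i. outer_content (E i))"
          using sum_le_suminf[of "\<lambda>i. outer_content (E i)" "{i}"] by simp
        then have "outer_content (E i) \<noteq> top" using fin by auto
        then have "outer_content (E i) < outer_content (E i) + ennreal (e * (1/2) ^ Suc i)"
          using e ennreal_add_left_cancel_less[of "outer_content (E i)" 0 "ennreal (e * (1/2) ^ Suc i)"]
          by simp
        then obtain U where "open U" "E i \<subseteq> U"
           "inner_content U < outer_content (E i) + ennreal (e * (1/2) ^ Suc i)"
          unfolding outer_content_def[of "E i"] INF_less_iff by auto
        then show ?thesis by (auto intro: less_imp_le)
      qed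
      then obtain U where U: "\<And>i. open (U i)" "\<And>i. E i \<subseteq> U i"
        "\<And>i. inner_content (U i) \<le> outer_content (E i) + ennreal (e * (1/2) ^ Suc i)" by metis
      have "outer_content (\<Union>i. E i) \<le> inner_content (\<Union>i. U i)"
        using U by (intro outer_content_le) auto
      also have "\<dots> \<le> (\<Sum>i. inner_content (U i))"
        using U(1) by (rule inner_content_countably_subadditive)
      also have "\<dots> \<le> (\<Sum>i. outer_content (E i) + ennreal (e * (1/2) ^ Suc i))"
        using U(3) by (intro suminf_le) auto
      also have "\<dots> = (\<Sum>i. outer_content (E i)) + (\<Sum>i. ennreal (e * (1/2) ^ Suc i))"
        by (rule suminf_add[symmetric]) auto
      also have "(\<Sum>i. ennreal (e * (1/2) ^ Suc i)) = ennreal e"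
        using sums_mult[OF power_half_series, of e] e
        by (intro suminf_ennreal_eq) auto
      finally show "outer_content (\<Union>i. E i) \<le> (\<Sum>i. outer_content (E i)) + ennreal e" .
    qed
  qed
qed

text \<open>Exhaust \<open>V \<inter> U\<close> from inside by a compact \<open>K\<close>, and then the open set \<open>V - K\<close>, which contains \<open>V - U\<close>, by a
compact \<open>L\<close>. The two are disjoint subsets of \<open>V\<close>.\<close>

lemma inner_content_open_split:
  assumes "open U" "open V"
  shows "inner_content (V \<inter> U) + outer_content (V - U) \<le> inner_content V"
proof -
  have ne: "{K. compact K \<and> K \<subseteq> W} \<noteq> {}" for W :: "'a set"
    using compact_empty by blast
  have "m K + outer_content (V - U) \<le> inner_content V" if K: "compact K" "K \<subseteq> V \<inter> U" for K
  proof -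
    have o: "open (V - K)" using assms K by (auto intro: compact_imp_closed)
    have "m K + m L \<le> inner_content V" if L: "compact L" "L \<subseteq> V - K" for L
    proof -
      have "m K + m L \<le> m (K \<union> L)" using K L by (intro content_disjoint) auto
      also have "\<dots> \<le> inner_content V" using K L by (intro content_le_inner) auto
      finally show ?thesis .
    qed
    then have "m K + inner_content (V - K) \<le> inner_content V"
      unfolding inner_content_def[of "V - K"]
      using ne by (subst ennreal_SUP_add_right) (auto intro: SUP_least)
    moreover have "outer_content (V - U) \<le> inner_content (V - K)"
      using K o by (intro outer_content_le) auto
    ultimately show ?thesis by (meson add_left_mono order_trans)
  qed
  then show ?thesis
    unfolding inner_content_def[of "V \<inter> U"]
    using ne by (subst ennreal_SUP_add_left[symmetric]) (auto intro: SUP_least)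
qed

lemma open_in_lambda_system:
  assumes U: "open U"
  shows "U \<in> lambda_system UNIV UNIV outer_content"
proof -
  have sub: "outer_content (x \<inter> U) + outer_content (x - U) \<le> outer_content x" for x
  proof (rule outer_content_ge)
    fix V assume V: "open V" "x \<subseteq> V"
    have "outer_content (x \<inter> U) + outer_content (x - U) \<le> inner_content (V \<inter> U) + outer_content (V - U)"
      using U V outer_content_outer_measure
      by (intro add_mono outer_content_le)
        (auto intro!: increasingD[of UNIV outer_content] simp: outer_measure_space_def)
    also have "\<dots> \<le> inner_content V" using U V by (intro inner_content_open_split)
    finally show "outer_content (x \<inter> U) + outer_content (x - U) \<le> inner_content V" .
  qed
  interpret algebra UNIV "UNIV :: 'a set set" by (rule algebra_Pow[of UNIV, simplified])
  have "subadditive UNIV outer_content"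
    using outer_content_outer_measure
    by (intro countably_subadditive_subadditive) (auto simp: outer_measure_space_def)
  then have "outer_content ((x \<inter> U) \<union> (x - U)) \<le> outer_content (x \<inter> U) + outer_content (x - U)" for x
    by (rule subadditiveD) auto
  moreover have "(x \<inter> U) \<union> (x - U) = x" for x by auto
  ultimately show ?thesis using sub unfolding lambda_system_eq by (auto intro: antisym)
qed

text \<open>The values on compact sets can grow, those on open sets are approximated from inside. These are the
two directions that the limit of a tight family needs: no mass is lost on compact sets, none is gained
on open sets.\<close>

lemma content_extends_to_borel_measure:
  obtains \<mu> :: "'a measure" where "sets \<mu> = sets borel"
    "\<And>K. compact K \<Longrightarrow> m K \<le> emeasure \<mu> K"
    "\<And>U. open U \<Longrightarrow> emeasure \<mu> U = (SUP K\<in>{K. compact K \<and> K \<subseteq> U}. m K)"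
proof -
  interpret sigma_algebra UNIV "UNIV :: 'a set set" by (rule sigma_algebra_Pow[of UNIV, simplified])
  define L where "L = lambda_system UNIV UNIV outer_content"
  have ms: "measure_space UNIV L outer_content"
    unfolding L_def by (rule caratheodory_lemma[OF outer_content_outer_measure])
  then interpret L: sigma_algebra UNIV L by (simp add: measure_space_def)
  have "sets borel \<subseteq> L"
    unfolding sets_borel using open_in_lambda_system by (intro L.sigma_sets_subset) (auto simp: L_def)
  then have bms: "measure_space UNIV (sets borel) outer_content"
    using ms sets.sigma_algebra_axioms[of "borel :: 'a measure"]
    by (auto simp: measure_space_def positive_def countably_additive_def subset_eq)
  define \<mu> :: "'a measure" where "\<mu> = measure_of UNIV (sets borel) outer_content"
  have \<mu>: "sets \<mu> = sets borel" "\<And>E. E \<in> sets borel \<Longrightarrow> emeasure \<mu> E = outer_content E"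
    using bms sigma_algebra.sets_measure_of_eq[of UNIV "sets (borel :: 'a measure)"]
    unfolding \<mu>_def measure_space_def
    by (auto simp: emeasure_measure_of_sigma)
  show thesis
    by (rule that[OF \<mu>(1)])
      (auto simp: \<mu>(2) borel_compact content_le_outer outer_content_open inner_content_def)
qed

end

section \<open>Cluster points of tight filters of probability measures\<close>

lemma borel_probs_iff:
  "\<pi> \<in> borel_probs S \<longleftrightarrow> prob_space \<pi> \<and> sets \<pi> = sets (restrict_space borel S)"
  by (auto simp: borel_probs_def space_prob_algebra)

lemma space_borel_probs: "\<pi> \<in> borel_probs S \<Longrightarrow> space \<pi> = S"
  using sets_eq_imp_space_eq[of \<pi> "restrict_space borel S"]
  by (simp add: borel_probs_iff space_restrict_space)

lemma borel_probs_sets: "\<pi> \<in> borel_probs S \<Longrightarrow> E \<in> sets borel \<Longrightarrow> S \<inter> E \<in> sets \<pi>"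
  by (auto simp: borel_probs_iff sets_restrict_space)

text \<open>Tychonoff's theorem for a power of the unit interval, in terms of filters. The image filter has a cluster
point \<open>l\<close>, and \<open>G\<close> adds to \<open>F\<close> the preimages of the neighbourhoods of \<open>l\<close>.\<close>

lemma setwise_cluster_point:
  fixes F :: "'x filter" and \<Phi> :: "'x \<Rightarrow> 'i \<Rightarrow> real"
  assumes F: "F \<noteq> bot" and bounded: "eventually (\<lambda>x. \<forall>i. \<Phi> x i \<in> {0..1}) F"
  obtains G l where "G \<noteq> bot" "G \<le> F" "\<And>i. ((\<lambda>x. \<Phi> x i) \<longlongrightarrow> l i) G"
proof -
  have "compactin (product_topology (\<lambda>i::'i. euclideanreal) UNIV) (PiE UNIV (\<lambda>_. {0..1}))"
    by (simp add: compactin_PiE)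
  then have "compact {f :: 'i \<Rightarrow> real. \<forall>i. f i \<in> {0..1}}"
    by (simp add: euclidean_product_topology PiE_def Pi_def)
  moreover have "filtermap \<Phi> F \<noteq> bot" using F by (simp add: filtermap_bot_iff)
  moreover have "eventually (\<lambda>f. f \<in> {f. \<forall>i. f i \<in> {0..1}}) (filtermap \<Phi> F)"
    using bounded by (simp add: eventually_filtermap)
  ultimately obtain l where l: "inf (nhds l) (filtermap \<Phi> F) \<noteq> bot"
    unfolding compact_filter by blast
  define G where "G = inf F (filtercomap \<Phi> (nhds l))"
  have "G \<noteq> bot"
  proof
    assume "G = bot"
    then have "eventually (\<lambda>_. False) G" by simp
    then obtain P Q where P: "eventually P F" and Q: "eventually Q (filtercomap \<Phi> (nhds l))"
      and PQ: "\<And>x. \<lbrakk>P x; Q x\<rbrakk> \<Longrightarrow> False"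
      unfolding G_def eventually_inf by blast
    obtain R where R: "eventually R (nhds l)" "\<And>x. R (\<Phi> x) \<Longrightarrow> Q x"
      using Q unfolding eventually_filtercomap by blast
    have "eventually (\<lambda>y. \<not> R y) (filtermap \<Phi> F)"
      using P by (auto simp: eventually_filtermap elim!: eventually_mono dest: PQ R(2))
    with R(1) have "eventually (\<lambda>_. False) (inf (nhds l) (filtermap \<Phi> F))"
      unfolding eventually_inf by blast
    with l show False by (simp add: trivial_limit_def)
  qed
  moreover have "G \<le> F" by (simp add: G_def)
  moreover have "((\<lambda>x. \<Phi> x i) \<longlongrightarrow> l i) G" for i
  proof -
    have "filterlim \<Phi> (nhds l) G"
      using filterlim_filtercomap by (rule filterlim_mono) (auto simp: G_def)
    then show ?thesis
      by (rule continuous_on_tendsto_compose[OF continuous_on_product_coordinates]) auto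
  qed
  ultimately show thesis by (rule that)
qed

text \<open>The portmanteau characterisation of weak convergence, \<open>\<mu>(U) \<le> liminf \<pi>(U)\<close> for relatively open \<open>U\<close>, for
measures \<open>\<pi>\<close> that move along a filter. It is closest to how the limit is constructed.\<close>

definition liminf_on_opens ::
  "'a::topological_space set \<Rightarrow> 'a measure filter \<Rightarrow> 'a measure \<Rightarrow> bool" where
  "liminf_on_opens S G \<mu> \<longleftrightarrow> (\<forall>U s. open U \<longrightarrow> s < measure \<mu> (S \<inter> U) \<longrightarrow>
      eventually (\<lambda>\<pi>. s < measure \<pi> (S \<inter> U)) G)"

text \<open>One half of Prokhorov's theorem. The set function \<open>l\<close> that is the limit along \<open>G\<close> is finitely
additive on all Borel sets, and its restriction to compact sets extends to a measure \<open>\<nu>\<close> with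
\<open>\<nu>(U) \<le> l(U)\<close> for open \<open>U\<close>. The sets \<open>K\<close> of the tightness hypothesis give \<open>\<nu>(S) = 1\<close>, so that \<open>\<nu>\<close>, constructed on the
whole space, lives on \<open>S\<close>.\<close>

lemma tight_filter_has_cluster_point:
  fixes S :: "'a::t4_space set"
  assumes S: "S \<in> sets borel" and F: "F \<noteq> bot"
    and probs: "eventually (\<lambda>\<pi>. \<pi> \<in> borel_probs S) F"
    and tight: "\<And>e. e > 0 \<Longrightarrow> \<exists>K\<subseteq>S. compact K \<and> eventually (\<lambda>\<pi>. 1 - e \<le> measure \<pi> K) F"
  obtains G \<mu> where "G \<noteq> bot" "G \<le> F" "\<mu> \<in> borel_probs S" "liminf_on_opens S G \<mu>"
proof -
  have "eventually (\<lambda>\<pi>. \<forall>E. measure \<pi> (S \<inter> E) \<in> {0..1}) F"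
    using probs by eventually_elim (auto simp: borel_probs_iff intro: prob_space.prob_le_1)
  then obtain G l where G: "G \<noteq> bot" "G \<le> F"
    and l: "\<And>E. ((\<lambda>\<pi>. measure \<pi> (S \<inter> E)) \<longlongrightarrow> l E) G"
    using setwise_cluster_point[OF F, of "\<lambda>\<pi> E. measure \<pi> (S \<inter> E)"] by blast
  have probs': "eventually (\<lambda>\<pi>. \<pi> \<in> borel_probs S) G"
    using G(2) probs by (rule filter_leD)
  have l0: "0 \<le> l E" for E
    using l by (rule tendsto_lowerbound) (auto simp: G)
  have l1: "l E \<le> 1" for E
    using l by (rule tendsto_upperbound)
      (use probs' in \<open>auto elim!: eventually_mono intro: prob_space.prob_le_1 simp: borel_probs_iff G\<close>)
  have l_mono: "l D \<le> l E" if "D \<subseteq> E" "D \<in> sets borel" "E \<in> sets borel" for D E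
  proof (rule tendsto_le[OF G(1) l l])
    show "eventually (\<lambda>\<pi>. measure \<pi> (S \<inter> D) \<le> measure \<pi> (S \<inter> E)) G"
      using probs'
    proof eventually_elim
      case (elim \<pi>)
      then interpret prob_space \<pi> by (simp add: borel_probs_iff)
      show ?case using elim that by (intro finite_measure_mono borel_probs_sets) auto
    qed
  qed
  have l_sub: "l (D \<union> E) \<le> l D + l E" if "D \<in> sets borel" "E \<in> sets borel" for D E
  proof (rule tendsto_le[OF G(1) tendsto_add[OF l l] l])
    show "eventually (\<lambda>\<pi>. measure \<pi> (S \<inter> (D \<union> E)) \<le> measure \<pi> (S \<inter> D) + measure \<pi> (S \<inter> E)) G"
      using probs'
    proof eventually_elim
      case (elim \<pi>)
      then interpret prob_space \<pi> by (simp add: borel_probs_iff)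
      show ?case using elim that unfolding Int_Un_distrib
        by (intro measure_Un_le borel_probs_sets) auto
    qed
  qed
  have l_add: "l D + l E \<le> l (D \<union> E)" if "D \<in> sets borel" "E \<in> sets borel" "D \<inter> E = {}" for D E
  proof (rule tendsto_le[OF G(1) l tendsto_add[OF l l]])
    show "eventually (\<lambda>\<pi>. measure \<pi> (S \<inter> D) + measure \<pi> (S \<inter> E) \<le> measure \<pi> (S \<inter> (D \<union> E))) G"
      using probs'
    proof eventually_elim
      case (elim \<pi>)
      then interpret prob_space \<pi> by (simp add: borel_probs_iff)
      show ?case using elim that unfolding Int_Un_distrib
        by (subst finite_measure_Union) (auto intro: borel_probs_sets)
    qed
  qed
  interpret compact_content "\<lambda>K. ennreal (l K)"
    by standard (auto simp: borel_compact l0 ennreal_plus[symmetric] simp del: ennreal_plus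
        intro!: ennreal_leI l_mono l_sub l_add)
  obtain \<nu> :: "'a measure" where \<nu>: "sets \<nu> = sets borel"
      "\<And>K. compact K \<Longrightarrow> ennreal (l K) \<le> emeasure \<nu> K"
      "\<And>U. open U \<Longrightarrow> emeasure \<nu> U = (SUP K\<in>{K. compact K \<and> K \<subseteq> U}. ennreal (l K))"
    using content_extends_to_borel_measure by blast
  have sp: "space \<nu> = UNIV" using sets_eq_imp_space_eq[OF \<nu>(1)] by simp
  have \<nu>_open: "emeasure \<nu> U \<le> ennreal (l U)" if "open U" for U
    unfolding \<nu>(3)[OF that] using that
    by (intro SUP_least ennreal_leI l_mono) (auto simp: borel_compact)
  have \<nu>1: "emeasure \<nu> E \<le> 1" if "E \<in> sets borel" for E
  proof -
    have "emeasure \<nu> E \<le> emeasure \<nu> UNIV" using that by (intro emeasure_mono) (auto simp: \<nu>(1))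
    also have "\<dots> \<le> ennreal (l UNIV)" by (rule \<nu>_open) auto
    also have "\<dots> \<le> 1" using l1[of UNIV] by (simp add: ennreal_le_1)
    finally show ?thesis .
  qed
  have \<nu>S: "emeasure \<nu> S = 1"
  proof (rule antisym[OF \<nu>1[OF S]])
    show "1 \<le> emeasure \<nu> S"
    proof (rule ennreal_le_epsilon)
      fix e :: real assume e: "0 < e"
      obtain K where K: "K \<subseteq> S" "compact K" "eventually (\<lambda>\<pi>. 1 - e \<le> measure \<pi> K) F"
        using tight[OF e] by blast
      have "1 - e \<le> l K"
        using l by (rule tendsto_lowerbound)
          (use K G filter_leD[OF G(2) K(3)] in \<open>auto simp: Int_absorb1\<close>)
      then have "1 \<le> ennreal (l K) + ennreal e"
        using l0 e by (simp add: ennreal_plus[symmetric] del: ennreal_plus)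
      also have "\<dots> \<le> emeasure \<nu> K + ennreal e" using \<nu>(2) K by (intro add_mono) auto
      also have "\<dots> \<le> emeasure \<nu> S + ennreal e"
        using K S by (intro add_mono emeasure_mono) (auto simp: \<nu>(1))
      finally show "1 \<le> emeasure \<nu> S + ennreal e" .
    qed
  qed
  define \<mu> where "\<mu> = restrict_space \<nu> S"
  have sets_\<mu>: "sets \<mu> = sets (restrict_space borel S)"
    by (simp add: \<mu>_def sets_restrict_space \<nu>(1))
  have em: "emeasure \<mu> E = emeasure \<nu> E" if "E \<subseteq> S" for E
    unfolding \<mu>_def using that S by (intro emeasure_restrict_space) (auto simp: \<nu>(1) sp)
  have "prob_space \<mu>"
    using \<nu>S em[of S] by (intro prob_spaceI) (simp add: \<mu>_def space_restrict_space sp)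
  then have \<mu>: "\<mu> \<in> borel_probs S" by (simp add: borel_probs_iff sets_\<mu>)
  have "liminf_on_opens S G \<mu>"
    unfolding liminf_on_opens_def
  proof (intro allI impI)
    fix U s assume U: "open U" and s: "s < measure \<mu> (S \<inter> U)"
    have "emeasure \<mu> (S \<inter> U) \<le> emeasure \<nu> U"
      using U by (subst em) (auto intro!: emeasure_mono simp: \<nu>(1))
    also have "\<dots> \<le> ennreal (l U)" using U by (rule \<nu>_open)
    finally have "measure \<mu> (S \<inter> U) \<le> l U"
      using l0 by (simp add: measure_def enn2real_leI)
    with s show "eventually (\<lambda>\<pi>. s < measure \<pi> (S \<inter> U)) G"
      using order_tendstoD(1)[OF l] by simp
  qed
  with G \<mu> show thesis by (intro that)
qed

section \<open>Integrals of lower semicontinuous functions\<close>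

text \<open>Lower semicontinuity in terms of relatively open sets, the form in which it meets \<open>liminf_on_opens\<close>.\<close>

definition open_superlevels_on :: "'a::topological_space set \<Rightarrow> ('a \<Rightarrow> real) \<Rightarrow> bool" where
  "open_superlevels_on S f \<longleftrightarrow> (\<forall>t. \<exists>U. open U \<and> {x \<in> S. t < f x} = S \<inter> U)"

lemma lower_semicontinuous_imp_open_superlevels:
  assumes "lower_semicontinuous_on S (\<lambda>x. ereal (f x))"
  shows "open_superlevels_on S f"
  unfolding open_superlevels_on_def
proof
  fix t
  have "\<exists>V. open V \<and> x \<in> V \<and> (\<forall>y\<in>S \<inter> V. t < f y)" if x: "x \<in> S" "t < f x" for x
  proof -
    have "ereal t < Liminf (at x within S) (\<lambda>x. ereal (f x))"
      using assms x unfolding lower_semicontinuous_on_def by (meson ereal_less_le less_ereal.simps(1) order_less_le_trans)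
    then have "eventually (\<lambda>y. t < f y) (at x within S)"
      using less_LiminfD by fastforce
    then obtain V where "open V" "x \<in> V" "\<forall>y\<in>V. y \<noteq> x \<longrightarrow> y \<in> S \<longrightarrow> t < f y"
      unfolding eventually_at_topological by blast
    then show ?thesis using x by (metis IntE)
  qed
  then obtain V where V: "\<And>x. \<lbrakk>x \<in> S; t < f x\<rbrakk> \<Longrightarrow> open (V x) \<and> x \<in> V x \<and> (\<forall>y\<in>S \<inter> V x. t < f y)"
    by metis
  show "\<exists>U. open U \<and> {x \<in> S. t < f x} = S \<inter> U"
    using V by (intro exI[of _ "\<Union>x\<in>{x \<in> S. t < f x}. V x"]) (auto intro!: open_UN)
qed

lemma continuous_imp_open_superlevels:
  fixes f :: "'a::topological_space \<Rightarrow> real"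
  assumes "continuous_on S f"
  shows "open_superlevels_on S f"
proof -
  have "\<exists>U. open U \<and> {x \<in> S. t < f x} = S \<inter> U" for t
  proof -
    have "openin (top_of_set S) (S \<inter> f -` {t<..})"
      using assms by (intro continuous_openin_preimage_gen) auto
    then show ?thesis unfolding openin_open by (auto simp: vimage_def Int_def)
  qed
  then show ?thesis by (simp add: open_superlevels_on_def)
qed

lemma open_superlevels_measurable:
  assumes "open_superlevels_on S f" "\<pi> \<in> borel_probs S"
  shows "f \<in> borel_measurable \<pi>"
  unfolding borel_measurable_iff_greater space_borel_probs[OF assms(2)]
proof
  fix t
  obtain U where "open U" "{x \<in> S. t < f x} = S \<inter> U"
    using assms(1) unfolding open_superlevels_on_def by blast
  then show "{x \<in> S. t < f x} \<in> sets \<pi>"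
    using assms(2) by (simp add: borel_probs_sets)
qed

lemma open_superlevels_add: "open_superlevels_on S f \<Longrightarrow> open_superlevels_on S (\<lambda>x. f x + m)"
  by (simp add: open_superlevels_on_def flip: diff_less_eq)

lemma eventually_less_sum:
  fixes a :: "'i \<Rightarrow> real"
  assumes "finite I" "\<And>i s. \<lbrakk>i \<in> I; s < a i\<rbrakk> \<Longrightarrow> eventually (\<lambda>x. s < b x i) F" "s < sum a I"
  shows "eventually (\<lambda>x. s < sum (b x) I) F"
proof -
  define d where "d = (sum a I - s) / (real (card I) + 1)"
  have d: "0 < d" "real (card I) * d < sum a I - s"
    using assms(3) by (auto simp: d_def field_simps)
  have "eventually (\<lambda>x. \<forall>i\<in>I. a i - d < b x i) F"
    using assms(1,2) d by (intro eventually_ball_finite) auto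
  then show ?thesis
  proof eventually_elim
    case (elim x)
    have "s < sum a I - real (card I) * d" using d by simp
    also have "\<dots> = (\<Sum>i\<in>I. a i - d)" by (simp add: sum_subtractf)
    also have "\<dots> \<le> sum (b x) I" using elim by (intro sum_mono) auto
    finally show ?case .
  qed
qed

text \<open>The Riemann sum of \<open>y = \<integral>\<^sub>0\<^sup>\<infinity> 1{s < y} ds\<close> on \<open>[0, n]\<close> with step \<open>1 / n\<close>. Composed with a lower semicontinuous \<open>f\<close> it
is a combination of indicators of open sets with nonnegative weights, to which \<open>liminf_on_opens\<close> applies
term by term.\<close>

definition staircase :: "nat \<Rightarrow> real \<Rightarrow> real" where
  "staircase n y = (\<Sum>k\<in>{1..n * n}. (1 / real n) * indicator {x. real k / real n < x} y)"

lemma staircase_card: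
  "staircase n y = real (card {k\<in>{1..n * n}. real k / real n < y}) / real n"
proof -
  have "(\<Sum>k\<in>{1..n * n}. indicator {x. real k / real n < x} y :: real)
      = real (card {k\<in>{1..n * n}. real k / real n < y})"
    by (simp add: indicator_def sum.If_cases Int_def)
  then show ?thesis unfolding staircase_def sum_distrib_left[symmetric] by simp
qed

lemma staircase_le:
  assumes "0 \<le> y" "0 < n"
  shows "staircase n y \<le> y"
proof -
  have "{k\<in>{1..n * n}. real k / real n < y} \<subseteq> {1..nat \<lfloor>real n * y\<rfloor>}"
    using assms by (auto simp: field_simps le_nat_floor less_imp_le)
  then have "card {k\<in>{1..n * n}. real k / real n < y} \<le> nat \<lfloor>real n * y\<rfloor>"
    using card_mono[of "{1..nat \<lfloor>real n * y\<rfloor>}"] by fastforce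
  also have "real (nat \<lfloor>real n * y\<rfloor>) \<le> real n * y" using assms by simp
  finally show ?thesis unfolding staircase_card using assms by (simp add: field_simps)
qed

lemma staircase_ge:
  assumes "y \<le> real n" "0 < n"
  shows "y - 1 / real n \<le> staircase n y"
proof (cases "0 < y")
  case True
  have *: "{1..<nat \<lceil>real n * y\<rceil>} \<subseteq> {k\<in>{1..n * n}. real k / real n < y}"
  proof
    fix k assume k: "k \<in> {1..<nat \<lceil>real n * y\<rceil>}"
    then have "int k < \<lceil>real n * y\<rceil>" by auto
    then have ky: "real k < real n * y" by (simp add: less_ceiling_iff)
    also have "\<dots> \<le> real n * real n" using assms by (intro mult_left_mono) auto
    finally have "k \<le> n * n" by (simp flip: of_nat_mult)
    with ky k assms show "k \<in> {k\<in>{1..n * n}. real k / real n < y}"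
      by (auto simp: field_simps)
  qed
  have "real n * y - 1 \<le> real (nat \<lceil>real n * y\<rceil>) - 1" by (simp add: real_nat_ceiling_ge)
  also have "\<dots> \<le> real (card {1..<nat \<lceil>real n * y\<rceil>})" by simp
  also have "\<dots> \<le> real (card {k\<in>{1..n * n}. real k / real n < y})"
    using card_mono[OF _ *] by simp
  finally have "(real n * y - 1) / real n \<le> staircase n y"
    unfolding staircase_card by (rule divide_right_mono) simp
  then show ?thesis using assms by (simp add: diff_divide_distrib)
next
  case False
  have "0 \<le> staircase n y" unfolding staircase_card by simp
  moreover have "0 \<le> 1 / real n" by simp
  ultimately show ?thesis using False by linarith
qed

lemma staircase_tendsto:
  assumes "0 \<le> y"
  shows "(\<lambda>n. staircase (Suc n) y) \<longlonglongrightarrow> y"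
proof (rule tendsto_sandwich)
  show "eventually (\<lambda>n. staircase (Suc n) y \<le> y) sequentially"
    using assms staircase_le by auto
  obtain N where N: "y \<le> real N" using real_arch_simple by blast
  show "eventually (\<lambda>n. y - 1 / real (Suc n) \<le> staircase (Suc n) y) sequentially"
    using eventually_ge_at_top[of N]
  proof eventually_elim
    case (elim n)
    then show ?case using N by (intro staircase_ge) auto
  qed
  show "(\<lambda>n. y - 1 / real (Suc n)) \<longlonglongrightarrow> y"
    using tendsto_diff[OF tendsto_const lim_inverse_n'[THEN LIMSEQ_Suc]] by simp
qed simp

lemma nn_integral_staircase:
  assumes \<pi>: "\<pi> \<in> borel_probs S" and U: "\<And>k. open (U k)"
    "\<And>k. {x \<in> S. real k / real n < f x} = S \<inter> U k"
  shows "(\<integral>\<^sup>+x. ennreal (staircase n (f x)) \<partial>\<pi>)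
    = ennreal (\<Sum>k\<in>{1..n * n}. (1 / real n) * measure \<pi> (S \<inter> U k))"
proof -
  interpret prob_space \<pi> using \<pi> by (simp add: borel_probs_iff)
  have mem: "S \<inter> U k \<in> sets \<pi>" for k using \<pi> U(1) by (simp add: borel_probs_sets)
  have "(\<integral>\<^sup>+x. ennreal (staircase n (f x)) \<partial>\<pi>)
      = (\<integral>\<^sup>+x. (\<Sum>k\<in>{1..n * n}. ennreal (1 / real n) * indicator (S \<inter> U k) x) \<partial>\<pi>)"
  proof (rule nn_integral_cong)
    fix x assume "x \<in> space \<pi>"
    then have x: "x \<in> S" by (simp add: space_borel_probs[OF \<pi>])
    have "(real k / real n < f x) = (x \<in> S \<inter> U k)" for k using U(2)[of k] x by blast
    then have "ennreal (1 / real n * indicator {y. real k / real n < y} (f x))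
        = ennreal (1 / real n) * indicator (S \<inter> U k) x" for k
      by (simp add: indicator_def)
    then show "ennreal (staircase n (f x)) = (\<Sum>k\<in>{1..n * n}. ennreal (1 / real n) * indicator (S \<inter> U k) x)"
      unfolding staircase_def by (subst sum_ennreal[symmetric]) simp_all
  qed
  also have "\<dots> = (\<Sum>k\<in>{1..n * n}. ennreal (1 / real n) * emeasure \<pi> (S \<inter> U k))"
    using mem by (subst nn_integral_sum) (auto simp: nn_integral_cmult_indicator)
  also have "\<dots> = ennreal (\<Sum>k\<in>{1..n * n}. (1 / real n) * measure \<pi> (S \<inter> U k))"
    by (subst sum_ennreal[symmetric]) (auto simp del: sum_ennreal simp: emeasure_eq_measure ennreal_mult[symmetric] intro!: sum.cong)
  finally show ?thesis .
qed

text \<open>Fatou's lemma is used for the sequence of staircases under the fixed measure \<open>\<mu>\<close>, which yields a single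
staircase whose integral already exceeds \<open>e\<close>. The passage to the limit along \<open>G\<close>, where Fatou's lemma would not
be at hand, then concerns a finite sum.\<close>

lemma nn_integral_liminf_on_opens:
  assumes G: "eventually (\<lambda>\<pi>. \<pi> \<in> borel_probs S) G" and \<mu>: "\<mu> \<in> borel_probs S"
    and lim: "liminf_on_opens S G \<mu>"
    and f: "open_superlevels_on S f" "\<And>x. x \<in> S \<Longrightarrow> 0 \<le> f x"
    and e: "e < (\<integral>\<^sup>+x. ennreal (f x) \<partial>\<mu>)"
  shows "eventually (\<lambda>\<pi>. e < (\<integral>\<^sup>+x. ennreal (f x) \<partial>\<pi>)) G"
proof -
  have fm: "f \<in> borel_measurable \<mu>" using f(1) \<mu> by (rule open_superlevels_measurable)
  have stm: "(\<lambda>x. staircase n (f x)) \<in> borel_measurable \<mu>" for n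
    unfolding staircase_def using fm by measurable
  have "(\<integral>\<^sup>+x. ennreal (f x) \<partial>\<mu>) = (\<integral>\<^sup>+x. liminf (\<lambda>n. ennreal (staircase (Suc n) (f x))) \<partial>\<mu>)"
  proof (rule nn_integral_cong)
    fix x assume "x \<in> space \<mu>"
    then have "0 \<le> f x" using f(2) by (simp add: space_borel_probs[OF \<mu>])
    then show "ennreal (f x) = liminf (\<lambda>n. ennreal (staircase (Suc n) (f x)))"
      using staircase_tendsto by (intro lim_imp_Liminf[symmetric] tendsto_ennrealI) auto
  qed
  also have "\<dots> \<le> liminf (\<lambda>n. \<integral>\<^sup>+x. ennreal (staircase (Suc n) (f x)) \<partial>\<mu>)"
    using stm by (intro nn_integral_liminf) auto
  finally have "e < liminf (\<lambda>n. \<integral>\<^sup>+x. ennreal (staircase (Suc n) (f x)) \<partial>\<mu>)"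
    using e by (rule order_less_le_trans[rotated])
  then have "eventually (\<lambda>n. e < (\<integral>\<^sup>+x. ennreal (staircase (Suc n) (f x)) \<partial>\<mu>)) sequentially"
    by (rule less_LiminfD)
  then obtain j where j: "e < (\<integral>\<^sup>+x. ennreal (staircase (Suc j) (f x)) \<partial>\<mu>)"
    using eventually_happens'[OF sequentially_bot] by blast
  define n where "n = Suc j"
  obtain V where V: "\<forall>t. open (V t) \<and> {x \<in> S. t < f x} = S \<inter> V t"
    using choice[OF f(1)[unfolded open_superlevels_on_def]] by blast
  define U where "U k = V (real k / real n)" for k :: nat
  have U: "open (U k)" "{x \<in> S. real k / real n < f x} = S \<inter> U k" for k
    using V by (simp_all add: U_def)
  define a where "a \<pi> k = (1 / real n) * measure \<pi> (S \<inter> U k)" for \<pi> k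
  note stair = nn_integral_staircase[OF _ U, folded a_def]
  have lt: "e < ennreal (\<Sum>k\<in>{1..n * n}. a \<mu> k)"
    using j unfolding n_def[symmetric] stair[OF \<mu>] .
  then obtain r where r: "e = ennreal r" "0 \<le> r" by (cases e) auto
  have "r < (\<Sum>k\<in>{1..n * n}. a \<mu> k)" using lt r by (simp add: ennreal_less_iff)
  then have "eventually (\<lambda>\<pi>. r < (\<Sum>k\<in>{1..n * n}. a \<pi> k)) G"
  proof (rule eventually_less_sum[rotated 2])
    fix k s assume "k \<in> {1..n*n}" "s < a \<mu> k"
    then have "s * real n < measure \<mu> (S \<inter> U k)" by (simp add: a_def n_def field_simps)
    then have "eventually (\<lambda>\<pi>. s * real n < measure \<pi> (S \<inter> U k)) G"
      using lim U(1) unfolding liminf_on_opens_def by blast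
    then show "eventually (\<lambda>\<pi>. s < a \<pi> k) G"
      by eventually_elim (simp add: a_def n_def field_simps)
  qed simp
  with G show ?thesis
  proof eventually_elim
    case (elim \<pi>)
    have "e < ennreal (\<Sum>k\<in>{1..n * n}. a \<pi> k)" using elim r by (simp add: ennreal_less_iff)
    also have "\<dots> = (\<integral>\<^sup>+x. ennreal (staircase n (f x)) \<partial>\<pi>)" using stair elim by simp
    also have "\<dots> \<le> (\<integral>\<^sup>+x. ennreal (f x) \<partial>\<pi>)"
      using f(2) elim staircase_le
      by (intro nn_integral_mono) (auto simp: space_borel_probs n_def intro!: ennreal_leI)
    finally show ?case .
  qed
qed

text \<open>The expected payoff against a point, see \<open>expected_payoff_dirac_II\<close> below. The
integral of the negative part is finite for the functions that are bounded below, and the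
expression \<open>\<infinity> + - \<infinity>\<close> does not arise.\<close>

definition extended_integral :: "'a measure \<Rightarrow> ('a \<Rightarrow> real) \<Rightarrow> ereal" where
  "extended_integral \<mu> f = enn2ereal (\<integral>\<^sup>+x. ennreal (max (f x) 0) \<partial>\<mu>)
     + - enn2ereal (\<integral>\<^sup>+x. ennreal (- min (f x) 0) \<partial>\<mu>)"

text \<open>Reduces the functions bounded below to nonnegative ones. The identity
\<open>(f + m) + f\<^sup>- = f\<^sup>+ + m\<close> is integrated, in which only \<open>f\<^sup>-\<close> has to be integrable.\<close>

lemma extended_integral_shift:
  assumes "prob_space \<mu>" and [measurable]: "f \<in> borel_measurable \<mu>"
    and m: "\<And>x. x \<in> space \<mu> \<Longrightarrow> - m \<le> f x" "0 \<le> m"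
  shows "extended_integral \<mu> f = enn2ereal (\<integral>\<^sup>+x. ennreal (f x + m) \<partial>\<mu>) - ereal m"
proof -
  interpret prob_space \<mu> by fact
  let ?P = "\<integral>\<^sup>+x. ennreal (max (f x) 0) \<partial>\<mu>" and ?N = "\<integral>\<^sup>+x. ennreal (- min (f x) 0) \<partial>\<mu>"
    and ?I = "\<integral>\<^sup>+x. ennreal (f x + m) \<partial>\<mu>"
  have "?I + ?N = (\<integral>\<^sup>+x. ennreal (f x + m) + ennreal (- min (f x) 0) \<partial>\<mu>)"
    by (rule nn_integral_add[symmetric]) measurable
  also have "\<dots> = (\<integral>\<^sup>+x. ennreal (max (f x) 0) + ennreal m \<partial>\<mu>)"
  proof (rule nn_integral_cong)
    fix x assume x: "x \<in> space \<mu>"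
    show "ennreal (f x + m) + ennreal (- min (f x) 0) = ennreal (max (f x) 0) + ennreal m"
      using m(1)[OF x] m(2)
      by (cases "f x \<le> 0") (auto simp: min_def max_def ennreal_plus[symmetric] simp del: ennreal_plus)
  qed
  also have "\<dots> = ?P + ennreal m"
    by (subst nn_integral_add) (auto simp: emeasure_space_1)
  finally have *: "?I + ?N = ?P + ennreal m" .
  have "?N \<le> (\<integral>\<^sup>+x. ennreal m \<partial>\<mu>)"
    using m(2) by (intro nn_integral_mono ennreal_leI) (auto simp: min_def dest: m(1))
  then have "?N \<le> ennreal m" by (simp add: emeasure_space_1)
  then have "?N < top" using le_less_trans by fastforce
  then obtain N where N: "?N = ennreal N" "0 \<le> N" by (cases ?N) auto
  from * show ?thesis
    unfolding extended_integral_def N(1) using m(2) N(2)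
    by (cases ?I; cases ?P)
      (auto simp: enn2ereal_ennreal ennreal_plus[symmetric] top_ennreal.rep_eq simp del: ennreal_plus)
qed

lemma extended_integral_gt_minf:
  assumes "prob_space \<mu>" "f \<in> borel_measurable \<mu>" "\<And>x. x \<in> space \<mu> \<Longrightarrow> - m \<le> f x" "0 \<le> m"
  shows "extended_integral \<mu> f > -\<infinity>"
  using extended_integral_shift[OF assms]
  by (cases "\<integral>\<^sup>+x. ennreal (f x + m) \<partial>\<mu>") (auto simp: enn2ereal_ennreal top_ennreal.rep_eq)

lemma extended_integral_uniform_shift:
  assumes f: "open_superlevels_on S f" "bdd_below (f ` S)"
  obtains m where "0 \<le> m" "\<And>x. x \<in> S \<Longrightarrow> - m \<le> f x"
    "\<And>\<pi>. \<pi> \<in> borel_probs S \<Longrightarrow>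
      extended_integral \<pi> f = enn2ereal (\<integral>\<^sup>+x. ennreal (f x + m) \<partial>\<pi>) - ereal m"
proof -
  obtain m0 where m0: "\<And>x. x \<in> S \<Longrightarrow> m0 \<le> f x" using f(2) by (auto simp: bdd_below_def)
  define m where "m = max 0 (- m0)"
  have m: "0 \<le> m" "\<And>x. x \<in> S \<Longrightarrow> - m \<le> f x" using m0 by (force simp: m_def)+
  have "extended_integral \<pi> f = enn2ereal (\<integral>\<^sup>+x. ennreal (f x + m) \<partial>\<pi>) - ereal m"
    if "\<pi> \<in> borel_probs S" for \<pi>
    using that m f(1)
    by (intro extended_integral_shift open_superlevels_measurable)
      (auto simp: borel_probs_iff space_borel_probs dest: space_borel_probs)
  with m show thesis by (rule that)
qed

lemma extended_integral_liminf_on_opens: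
  assumes G: "eventually (\<lambda>\<pi>. \<pi> \<in> borel_probs S) G" and \<mu>: "\<mu> \<in> borel_probs S"
    and lim: "liminf_on_opens S G \<mu>"
    and f: "open_superlevels_on S f" "bdd_below (f ` S)"
    and s: "s < extended_integral \<mu> f"
  shows "eventually (\<lambda>\<pi>. s < extended_integral \<pi> f) G"
proof -
  obtain m where m: "0 \<le> m" "\<And>x. x \<in> S \<Longrightarrow> - m \<le> f x"
    and shift: "\<And>\<pi>. \<pi> \<in> borel_probs S \<Longrightarrow>
      extended_integral \<pi> f = enn2ereal (\<integral>\<^sup>+x. ennreal (f x + m) \<partial>\<pi>) - ereal m"
    using extended_integral_uniform_shift[OF f(1,2)] by blast
  have s': "s + ereal m < enn2ereal (\<integral>\<^sup>+x. ennreal (f x + m) \<partial>\<mu>)"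
    using s unfolding shift[OF \<mu>] by (simp add: ereal_less_minus_iff)
  show ?thesis
  proof (cases "s + ereal m < 0")
    case True
    from G show ?thesis
    proof eventually_elim
      case (elim \<pi>)
      have "s + ereal m < enn2ereal (\<integral>\<^sup>+x. ennreal (f x + m) \<partial>\<pi>)"
        using True enn2ereal_nonneg by (rule order_less_le_trans)
      then show ?case using shift[OF elim] by (simp add: ereal_less_minus_iff)
    qed
  next
    case False
    define e where "e = e2ennreal (s + ereal m)"
    have e: "enn2ereal e = s + ereal m" using False by (simp add: e_def enn2ereal_e2ennreal)
    have "e < (\<integral>\<^sup>+x. ennreal (f x + m) \<partial>\<mu>)" using s' e by (simp add: less_ennreal.rep_eq)
    then have "eventually (\<lambda>\<pi>. e < (\<integral>\<^sup>+x. ennreal (f x + m) \<partial>\<pi>)) G"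
      using m(2) by (intro nn_integral_liminf_on_opens[OF G \<mu> lim] open_superlevels_add f(1))
        (force simp: add.commute)+
    with G show ?thesis
    proof eventually_elim
      case (elim \<pi>)
      then show ?case using shift e by (simp add: less_ennreal.rep_eq ereal_less_minus_iff)
    qed
  qed
qed

lemma extended_integral_le_on_limit:
  assumes "G \<noteq> bot" "eventually (\<lambda>\<pi>. \<pi> \<in> borel_probs S) G" "\<mu> \<in> borel_probs S"
    "liminf_on_opens S G \<mu>" "open_superlevels_on S f" "bdd_below (f ` S)"
    and le: "eventually (\<lambda>\<pi>. extended_integral \<pi> f \<le> r) G"
  shows "extended_integral \<mu> f \<le> r"
proof (rule ccontr)
  assume "\<not> ?thesis"
  then have "eventually (\<lambda>\<pi>. r < extended_integral \<pi> f) G"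
    using assms by (intro extended_integral_liminf_on_opens) auto
  with le have "eventually (\<lambda>_. False) G" by eventually_elim auto
  with assms(1) show False by (simp add: trivial_limit_def)
qed

lemma extended_integral_eq_integral:
  assumes "integrable \<mu> f"
  shows "extended_integral \<mu> f = ereal (integral\<^sup>L \<mu> f)"
proof -
  have i: "integrable \<mu> (\<lambda>x. max (f x) 0)" "integrable \<mu> (\<lambda>x. - min (f x) 0)"
    using assms by auto
  have "integral\<^sup>L \<mu> f = (\<integral>x. max (f x) 0 - (- min (f x) 0) \<partial>\<mu>)"
    by (intro Bochner_Integration.integral_cong) (auto simp: max_def min_def)
  also have "\<dots> = (\<integral>x. max (f x) 0 \<partial>\<mu>) - (\<integral>x. - min (f x) 0 \<partial>\<mu>)"
    using i by (rule Bochner_Integration.integral_diff)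
  finally have "integral\<^sup>L \<mu> f = (\<integral>x. max (f x) 0 \<partial>\<mu>) - (\<integral>x. - min (f x) 0 \<partial>\<mu>)" .
  moreover have "0 \<le> (\<integral>x. max (f x) 0 \<partial>\<mu>)" "0 \<le> (\<integral>x. - min (f x) 0 \<partial>\<mu>)"
    by (rule Bochner_Integration.integral_nonneg, simp)+
  ultimately show ?thesis
    unfolding extended_integral_def using i
    by (subst (1 2) nn_integral_eq_integral) (auto simp: enn2ereal_ennreal)
qed

lemma liminf_on_opens_imp_weak_limit:
  fixes f :: "'a::topological_space \<Rightarrow> real"
  assumes G: "eventually (\<lambda>\<pi>. \<pi> \<in> borel_probs S) G" and \<mu>: "\<mu> \<in> borel_probs S"
    and lim: "liminf_on_opens S G \<mu>"
    and f: "continuous_on S f" "bounded (f ` S)"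
  shows "((\<lambda>\<pi>. \<integral>x. f x \<partial>\<pi>) \<longlongrightarrow> (\<integral>x. f x \<partial>\<mu>)) G"
proof -
  have ext: "extended_integral \<pi> g = ereal (\<integral>x. g x \<partial>\<pi>)"
    if \<pi>: "\<pi> \<in> borel_probs S" and g: "continuous_on S g" "bounded (g ` S)"
    for \<pi> and g :: "'a \<Rightarrow> real"
  proof -
    interpret prob_space \<pi> using \<pi> by (simp add: borel_probs_iff)
    obtain M where "\<And>x. x \<in> S \<Longrightarrow> norm (g x) \<le> M" using g(2) by (auto simp: bounded_iff)
    then have "integrable \<pi> g"
      using \<pi> g by (intro integrable_const_bound[of _ M] open_superlevels_measurable
          continuous_imp_open_superlevels) (auto simp: space_borel_probs)
    then show ?thesis by (rule extended_integral_eq_integral)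
  qed
  have lower: "eventually (\<lambda>\<pi>. s < (\<integral>x. g x \<partial>\<pi>)) G"
    if g: "continuous_on S g" "bounded (g ` S)" and s: "s < (\<integral>x. g x \<partial>\<mu>)"
    for s and g :: "'a \<Rightarrow> real"
  proof -
    have "eventually (\<lambda>\<pi>. ereal s < extended_integral \<pi> g) G"
      using g s ext[OF \<mu> g] bounded_imp_bdd_below
      by (intro extended_integral_liminf_on_opens[OF G \<mu> lim] continuous_imp_open_superlevels) auto
    with G show ?thesis by eventually_elim (simp add: ext[OF _ g])
  qed
  show ?thesis
  proof (rule order_tendstoI)
    show "eventually (\<lambda>\<pi>. s < (\<integral>x. f x \<partial>\<pi>)) G" if "s < (\<integral>x. f x \<partial>\<mu>)" for s
      using f that by (rule lower)
    show "eventually (\<lambda>\<pi>. (\<integral>x. f x \<partial>\<pi>) < s) G" if "(\<integral>x. f x \<partial>\<mu>) < s" for s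
      using lower[of "\<lambda>x. - f x" "- s"] f that
      by (auto simp: continuous_on_minus bounded_uminus image_image[symmetric, of uminus f])
  qed
qed

text \<open>By induction on the generation of the topology, only its subbase has to be considered.\<close>

lemma eventually_in_weak_open:
  assumes G: "eventually (\<lambda>\<pi>. \<pi> \<in> borel_probs S) G" and \<mu>: "\<mu> \<in> borel_probs S"
    and lim: "liminf_on_opens S G \<mu>"
    and W: "openin (weak_topology S) W" "\<mu> \<in> W"
  shows "eventually (\<lambda>\<pi>. \<pi> \<in> W) G"
proof -
  have "\<mu> \<in> W \<longrightarrow> eventually (\<lambda>\<pi>. \<pi> \<in> W) G"
    using W(1) unfolding weak_topology_def openin_topology_generated_by_iff
  proof induction
    case Empty
    then show ?case by simp
  next
    case (Int a b)
    then show ?case by (auto intro: eventually_conj)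
  next
    case (UN K)
    have "eventually (\<lambda>\<pi>. \<pi> \<in> \<Union>K) G" if "k \<in> K" "\<mu> \<in> k" for k
      using UN.IH[OF that(1)] that by (auto elim!: eventually_mono)
    then show ?case by blast
  next
    case (Basis s)
    then obtain f :: "'a \<Rightarrow> real" and U where s: "s = {\<mu> \<in> borel_probs S. (\<integral>x. f x \<partial>\<mu>) \<in> U}"
      and f: "continuous_on S f" "bounded (f ` S)" "open U" by auto
    show ?case
    proof
      assume "\<mu> \<in> s"
      then have "eventually (\<lambda>\<pi>. (\<integral>x. f x \<partial>\<pi>) \<in> U) G"
        using liminf_on_opens_imp_weak_limit[OF G \<mu> lim f(1,2)] f(3) s
        by (auto simp: tendsto_def)
      with G show "eventually (\<lambda>\<pi>. \<pi> \<in> s) G" by eventually_elim (simp add: s)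
    qed
  qed
  with W(2) show ?thesis by simp
qed

section \<open>Integrals under mixtures of measures\<close>

lemma nn_integral_mixture:
  assumes \<nu>: "sets \<nu> = sets \<mu>" and f: "f \<in> borel_measurable \<mu>"
  shows "(\<integral>\<^sup>+x. f x \<partial>mixture t \<mu> \<nu>)
    = ennreal t * (\<integral>\<^sup>+x. f x \<partial>\<mu>) + ennreal (1 - t) * (\<integral>\<^sup>+x. f x \<partial>\<nu>)"
proof -
  have cm: "borel_measurable (mixture t \<mu> \<nu>) = borel_measurable \<mu>"
      "borel_measurable \<nu> = borel_measurable \<mu>"
    by (auto intro!: measurable_cong_sets simp: sets_mixture \<nu>)
  from f show ?thesis
  proof (induction rule: borel_measurable_induct)
    case (cong f g)
    have "space (mixture t \<mu> \<nu>) = space \<mu>" "space \<nu> = space \<mu>"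
      using sets_eq_imp_space_eq[OF sets_mixture[of t \<mu> \<nu>]] sets_eq_imp_space_eq[OF \<nu>] by auto
    then have "integral\<^sup>N \<pi> f = integral\<^sup>N \<pi> g" if "\<pi> \<in> {\<mu>, \<nu>, mixture t \<mu> \<nu>}" for \<pi>
      using cong(3) that by (intro nn_integral_cong) auto
    with cong(4) show ?case by simp
  next
    case (set A)
    then show ?case using \<nu> by (simp add: sets_mixture emeasure_mixture)
  next
    case (mult u c)
    then show ?case
      by (simp add: nn_integral_cmult cm distrib_left ac_simps)
  next
    case (add u v)
    then show ?case by (simp add: nn_integral_add cm distrib_left ac_simps)
  next
    case (seq U)
    have inc: "incseq (\<lambda>i. \<integral>\<^sup>+x. U i x \<partial>\<mu>)" "incseq (\<lambda>i. \<integral>\<^sup>+x. U i x \<partial>\<nu>)"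
      using seq(3) by (auto simp: incseq_def le_fun_def intro!: nn_integral_mono)
    have "(\<integral>\<^sup>+x. (SUP i. U i x) \<partial>mixture t \<mu> \<nu>) = (SUP i. \<integral>\<^sup>+x. U i x \<partial>mixture t \<mu> \<nu>)"
      using seq by (intro nn_integral_monotone_convergence_SUP) (auto simp: cm)
    also have "\<dots> = (SUP i. ennreal t * (\<integral>\<^sup>+x. U i x \<partial>\<mu>) + ennreal (1 - t) * (\<integral>\<^sup>+x. U i x \<partial>\<nu>))"
      using seq by simp
    also have "\<dots> = (SUP i. ennreal t * (\<integral>\<^sup>+x. U i x \<partial>\<mu>)) + (SUP i. ennreal (1 - t) * (\<integral>\<^sup>+x. U i x \<partial>\<nu>))"
      using inc by (intro ennreal_SUP_add) (auto simp: incseq_def intro!: mult_left_mono)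
    also have "\<dots> = ennreal t * (SUP i. \<integral>\<^sup>+x. U i x \<partial>\<mu>) + ennreal (1 - t) * (SUP i. \<integral>\<^sup>+x. U i x \<partial>\<nu>)"
      by (simp add: SUP_mult_left_ennreal)
    also have "(SUP i. \<integral>\<^sup>+x. U i x \<partial>\<mu>) = (\<integral>\<^sup>+x. (SUP i. U i x) \<partial>\<mu>)"
      using seq by (intro nn_integral_monotone_convergence_SUP[symmetric]) auto
    also have "(SUP i. \<integral>\<^sup>+x. U i x \<partial>\<nu>) = (\<integral>\<^sup>+x. (SUP i. U i x) \<partial>\<nu>)"
      using seq by (intro nn_integral_monotone_convergence_SUP[symmetric]) (auto simp: cm)
    finally show ?case by (simp add: SUP_apply[abs_def] image_image)
  qed
qed

lemma extended_integral_mixture: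
  assumes \<mu>: "\<mu> \<in> borel_probs S" and \<nu>: "\<nu> \<in> borel_probs S" and t: "0 \<le> t" "t \<le> 1"
    and f: "open_superlevels_on S f" "bdd_below (f ` S)"
  shows "extended_integral (mixture t \<mu> \<nu>) f
    = ereal t * extended_integral \<mu> f + ereal (1 - t) * extended_integral \<nu> f"
proof -
  obtain m where m: "0 \<le> m" "\<And>x. x \<in> S \<Longrightarrow> - m \<le> f x"
    and shift: "\<And>\<pi>. \<pi> \<in> borel_probs S \<Longrightarrow>
      extended_integral \<pi> f = enn2ereal (\<integral>\<^sup>+x. ennreal (f x + m) \<partial>\<pi>) - ereal m"
    using extended_integral_uniform_shift[OF f(1,2)] by blast
  have mix: "mixture t \<mu> \<nu> \<in> borel_probs S"
    using convex_borel_probs[of S] \<mu> \<nu> t by (auto simp: convex_measures_def)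
  have [measurable]: "f \<in> borel_measurable \<mu>" using f(1) \<mu> by (rule open_superlevels_measurable)
  let ?I = "\<lambda>\<pi>. \<integral>\<^sup>+x. ennreal (f x + m) \<partial>\<pi>"
  have "?I (mixture t \<mu> \<nu>) = ennreal t * ?I \<mu> + ennreal (1 - t) * ?I \<nu>"
    using \<mu> \<nu> by (intro nn_integral_mixture) (auto simp: borel_probs_iff)
  then have "enn2ereal (?I (mixture t \<mu> \<nu>)) = ereal t * enn2ereal (?I \<mu>) + ereal (1 - t) * enn2ereal (?I \<nu>)"
    using t by (simp add: plus_ennreal.rep_eq times_ennreal.rep_eq enn2ereal_ennreal)
  then show ?thesis
    unfolding shift[OF \<mu>] shift[OF \<nu>] shift[OF mix] using t
    by (cases "?I \<mu>"; cases "?I \<nu>"; cases "t = 0"; cases "t = 1")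
      (auto simp: enn2ereal_ennreal top_ennreal.rep_eq algebra_simps)
qed

section \<open>Tightness from inf-compactness\<close>

text \<open>By Markov's inequality, a bound on the integral of \<open>f\<close> limits the mass outside the sublevel set of
\<open>f\<close> at a high level \<open>l\<close>, and this set is compact.\<close>

lemma coercive_bound_imp_cluster_point:
  fixes S :: "'a::t4_space set"
  assumes S: "S \<in> sets borel"
    and f: "open_superlevels_on S f" "bdd_below (f ` S)" "inf_compact_on S (\<lambda>x. ereal (f x))"
    and F: "F \<noteq> bot" "eventually (\<lambda>\<pi>. \<pi> \<in> borel_probs S) F"
    and T: "eventually (\<lambda>\<pi>. extended_integral \<pi> f \<le> ereal T) F"
  obtains G \<mu> where "G \<noteq> bot" "G \<le> F" "\<mu> \<in> borel_probs S" "liminf_on_opens S G \<mu>"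
proof (rule tight_filter_has_cluster_point[OF S F])
  obtain m where m: "0 \<le> m" "\<And>x. x \<in> S \<Longrightarrow> - m \<le> f x"
    and shift: "\<And>\<pi>. \<pi> \<in> borel_probs S \<Longrightarrow>
      extended_integral \<pi> f = enn2ereal (\<integral>\<^sup>+x. ennreal (f x + m) \<partial>\<pi>) - ereal m"
    using extended_integral_uniform_shift[OF f(1,2)] by blast
  fix e :: real assume e: "0 < e"
  \<comment> \<open>The level makes \<open>(T + m) / l \<le> e\<close>; adding \<open>1\<close> keeps it positive.\<close>
  define l where "l = (\<bar>T\<bar> + m + 1) / e"
  have l: "0 < l" "\<bar>T\<bar> + m \<le> e * l" using e m(1) by (auto simp: l_def)
  define K where "K = {x \<in> S. ereal (f x) \<le> ereal l}"
  have K: "K \<subseteq> S" "compact K" using f(3) by (auto simp: K_def inf_compact_on_def)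
  have "eventually (\<lambda>\<pi>. 1 - e \<le> measure \<pi> K) F"
    using F(2) T
  proof eventually_elim
    case (elim \<pi>)
    interpret prob_space \<pi> using elim by (simp add: borel_probs_iff)
    have sp: "space \<pi> = S" using elim by (simp add: space_borel_probs)
    have KS: "K \<in> sets \<pi>"
      using borel_probs_sets[OF elim(1) borel_compact[OF K(2)]] K(1) by (simp add: Int_absorb1)
    have D: "S - K \<in> sets \<pi>" using sets.compl_sets[OF KS] by (simp add: sp)
    have "enn2ereal (\<integral>\<^sup>+x. ennreal (f x + m) \<partial>\<pi>) \<le> ereal (T + m)"
      using elim(2) unfolding shift[OF elim(1)] by (simp add: ereal_minus_le)
    also have "\<dots> \<le> enn2ereal (ennreal (\<bar>T\<bar> + m))"
      using m(1) by (subst enn2ereal_ennreal) auto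
    finally have I: "(\<integral>\<^sup>+x. ennreal (f x + m) \<partial>\<pi>) \<le> ennreal (\<bar>T\<bar> + m)"
      by (simp add: less_eq_ennreal.rep_eq)
    have "ennreal (l * measure \<pi> (S - K)) = (\<integral>\<^sup>+x. ennreal l * indicator (S - K) x \<partial>\<pi>)"
      using D l(1) by (simp add: nn_integral_cmult_indicator emeasure_eq_measure ennreal_mult)
    also have "\<dots> \<le> (\<integral>\<^sup>+x. ennreal (f x + m) \<partial>\<pi>)"
      using m(1) by (intro nn_integral_mono) (auto simp: indicator_def K_def intro!: ennreal_leI)
    also note I
    finally have "l * measure \<pi> (S - K) \<le> \<bar>T\<bar> + m"
      by (rule ennreal_le_iff[THEN iffD1, rotated]) (use m(1) in auto)
    also have "\<dots> \<le> l * e" using l(2) by (simp add: mult.commute)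
    finally have "measure \<pi> (S - K) \<le> e" using l(1) by simp
    moreover have "measure \<pi> (S - K) = 1 - measure \<pi> K" using prob_compl[OF KS] by (simp add: sp)
    ultimately show ?case by simp
  qed
  with K show "\<exists>K\<subseteq>S. compact K \<and> eventually (\<lambda>\<pi>. 1 - e \<le> measure \<pi> K) F" by blast
qed (use that in blast)

section \<open>Expected payoffs and weak duality\<close>

lemma dirac_on_borel_probs: "x \<in> S \<Longrightarrow> dirac_on S x \<in> borel_probs S"
  unfolding dirac_on_def borel_probs_iff
  by (auto intro!: prob_space_return simp: space_restrict_space)

lemma nn_integral_dirac_on:
  "x \<in> S \<Longrightarrow> f \<in> borel_measurable (restrict_space borel S) \<Longrightarrow> (\<integral>\<^sup>+y. f y \<partial>dirac_on S x) = f x"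
  unfolding dirac_on_def by (rule nn_integral_return) (auto simp: space_restrict_space)

lemma measurable_borel_probs: "\<pi> \<in> borel_probs S \<Longrightarrow> borel_measurable \<pi> = borel_measurable (restrict_space borel S)"
  by (auto simp: borel_probs_iff intro!: measurable_cong_sets)

text \<open>Inequalities for a difference are moved to sums in \<^typ>\<open>ennreal\<close>, where they may be integrated even
when both parts of the payoff have infinite integral. The constant is split by sign for the same reason.\<close>

lemma le_difference_imp_add_le:
  assumes "ereal L \<le> enn2ereal P + - enn2ereal N" "P \<noteq> top"
  shows "ennreal (max L 0) + N \<le> P + ennreal (max (- L) 0)"
  using assms
  by (cases P; cases N)
    (auto simp: enn2ereal_ennreal ennreal_plus[symmetric] top_ennreal.rep_eq max_def simp del: ennreal_plus)

lemma difference_le_imp_add_le: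
  assumes "enn2ereal P + - enn2ereal N \<le> ereal U" "N \<noteq> top"
  shows "P + ennreal (max (- U) 0) \<le> N + ennreal (max U 0)"
  using assms
  by (cases P; cases N)
    (auto simp: enn2ereal_ennreal ennreal_plus[symmetric] top_ennreal.rep_eq max_def simp del: ennreal_plus)

context zero_sum_game
begin

lemma payoff_slice_I: "b \<in> B \<Longrightarrow> (\<lambda>a. c a b) \<in> borel_measurable (restrict_space borel A)"
proof -
  assume b: "b \<in> B"
  have "(\<lambda>a. (a, b)) \<in> restrict_space borel A \<rightarrow>\<^sub>M restrict_space borel (A \<times> B)"
    using b by (intro measurable_restrict_space2 measurable_restrict_space1)
      (auto simp: space_restrict_space intro!: borel_measurable_continuous_onI continuous_intros)
  from measurable_compose[OF this payoff_measurable] show ?thesis by simp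
qed

lemma payoff_slice_II: "a \<in> A \<Longrightarrow> c a \<in> borel_measurable (restrict_space borel B)"
proof -
  assume a: "a \<in> A"
  have "(\<lambda>b. (a, b)) \<in> restrict_space borel B \<rightarrow>\<^sub>M restrict_space borel (A \<times> B)"
    using a by (intro measurable_restrict_space2 measurable_restrict_space1)
      (auto simp: space_restrict_space intro!: borel_measurable_continuous_onI continuous_intros)
  from measurable_compose[OF this payoff_measurable] show ?thesis by simp
qed

lemma payoff_jointly_measurable:
  assumes "\<pi>A \<in> borel_probs A" "\<pi>B \<in> borel_probs B"
  shows "(\<lambda>(a, b). c a b) \<in> borel_measurable (\<pi>A \<Otimes>\<^sub>M \<pi>B)"
proof -
  have s: "sets \<pi>A = sets (restrict_space borel A)" "sets \<pi>B = sets (restrict_space borel B)"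
    using assms by (auto simp: borel_probs_iff)
  have "(\<lambda>a. a) \<in> restrict_space borel A \<rightarrow>\<^sub>M borel" "(\<lambda>b. b) \<in> restrict_space borel B \<rightarrow>\<^sub>M borel"
    by (rule measurable_restrict_space1, simp)+
  then have i: "(\<lambda>a. a) \<in> \<pi>A \<rightarrow>\<^sub>M borel" "(\<lambda>b. b) \<in> \<pi>B \<rightarrow>\<^sub>M borel"
    using measurable_cong_sets[OF s(1) refl] measurable_cong_sets[OF s(2) refl] by auto
  have "(\<lambda>z. (fst z, snd z)) \<in> \<pi>A \<Otimes>\<^sub>M \<pi>B \<rightarrow>\<^sub>M borel \<Otimes>\<^sub>M borel"
    by (intro measurable_Pair measurable_compose[OF measurable_fst i(1)] measurable_compose[OF measurable_snd i(2)])
  then have "(\<lambda>z. z) \<in> \<pi>A \<Otimes>\<^sub>M \<pi>B \<rightarrow>\<^sub>M restrict_space borel (A \<times> B)"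
    using assms by (intro measurable_restrict_space2)
      (auto simp: space_pair_measure space_borel_probs borel_prod)
  from measurable_compose[OF this payoff_measurable] show ?thesis by simp
qed

lemma expected_payoff_dirac_II:
  assumes \<pi>: "\<pi> \<in> borel_probs A" and b: "b \<in> B"
  shows "expected_payoff c \<pi> (dirac_on B b) = extended_integral \<pi> (\<lambda>a. c a b)"
proof -
  have eq: "(\<integral>\<^sup>+a. (\<integral>\<^sup>+b'. g (c a b') \<partial>dirac_on B b) \<partial>\<pi>) = (\<integral>\<^sup>+a. g (c a b) \<partial>\<pi>)"
    if "g \<in> borel_measurable borel" for g :: "real \<Rightarrow> ennreal"
    using that b payoff_slice_II
    by (intro nn_integral_cong nn_integral_dirac_on) (auto simp: space_borel_probs[OF \<pi>])
  have "(\<lambda>x::real. ennreal (max x 0)) \<in> borel_measurable borel"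
    "(\<lambda>x::real. ennreal (- min x 0)) \<in> borel_measurable borel" by measurable
  from this[THEN eq] show ?thesis
    unfolding expected_payoff_def payoff_pos_def payoff_neg_def extended_integral_def
    by (simp only:)
qed

lemma expected_payoff_dirac_I:
  assumes a: "a \<in> A" and \<pi>: "\<pi> \<in> borel_probs B"
  shows "expected_payoff c (dirac_on A a) \<pi> = extended_integral \<pi> (c a)"
proof -
  interpret prob_space \<pi> using \<pi> by (simp add: borel_probs_iff)
  have "(\<integral>\<^sup>+a'. (\<integral>\<^sup>+b. g (c a' b) \<partial>\<pi>) \<partial>dirac_on A a) = (\<integral>\<^sup>+b. g (c a b) \<partial>\<pi>)"
    if g: "g \<in> borel_measurable borel" for g :: "real \<Rightarrow> ennreal"
  proof (rule nn_integral_dirac_on[OF a])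
    have "(\<lambda>(a, b). g (c a b)) \<in> borel_measurable (dirac_on A a \<Otimes>\<^sub>M \<pi>)"
      using measurable_compose[OF payoff_jointly_measurable[OF dirac_on_borel_probs[OF a] \<pi>] g]
      by (simp add: case_prod_beta')
    then have "(\<lambda>a'. \<integral>\<^sup>+b. g (c a' b) \<partial>\<pi>) \<in> borel_measurable (dirac_on A a)"
      by (rule borel_measurable_nn_integral)
    then show "(\<lambda>a'. \<integral>\<^sup>+b. g (c a' b) \<partial>\<pi>) \<in> borel_measurable (restrict_space borel A)"
      by (simp add: measurable_borel_probs[OF dirac_on_borel_probs[OF a]])
  qed
  note eq = this
  have "(\<lambda>x::real. ennreal (max x 0)) \<in> borel_measurable borel"
    "(\<lambda>x::real. ennreal (- min x 0)) \<in> borel_measurable borel" by measurable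
  from this[THEN eq] show ?thesis
    unfolding expected_payoff_def payoff_pos_def payoff_neg_def extended_integral_def
    by (simp only:)
qed

lemma payoff_flat_eq:
  "\<pi> \<in> borel_probs B \<Longrightarrow> payoff_flat A c \<pi> = (INF a\<in>A. extended_integral \<pi> (c a))"
  unfolding payoff_flat_def by (intro INF_cong) (auto simp: expected_payoff_dirac_I)

lemma payoff_sharp_eq:
  "\<pi> \<in> borel_probs A \<Longrightarrow> payoff_sharp B c \<pi> = (SUP b\<in>B. extended_integral \<pi> (\<lambda>a. c a b))"
  unfolding payoff_sharp_def by (intro SUP_cong) (auto simp: expected_payoff_dirac_II)

lemma positive_part_bounded:
  assumes a: "a \<in> A"
  shows "\<exists>M\<ge>0. \<forall>\<pi>\<in>borel_probs B. (\<integral>\<^sup>+b. ennreal (max (c a b) 0) \<partial>\<pi>) \<le> ennreal M"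
proof -
  obtain M where M: "\<And>b. b \<in> B \<Longrightarrow> c a b \<le> M"
    using payoff_bdd_above[OF a] by (auto simp: bdd_above_def)
  have "(\<integral>\<^sup>+b. ennreal (max (c a b) 0) \<partial>\<pi>) \<le> ennreal (max M 0)" if \<pi>: "\<pi> \<in> borel_probs B" for \<pi>
  proof -
    interpret prob_space \<pi> using \<pi> by (simp add: borel_probs_iff)
    have "(\<integral>\<^sup>+b. ennreal (max (c a b) 0) \<partial>\<pi>) \<le> (\<integral>\<^sup>+b. ennreal (max M 0) \<partial>\<pi>)"
      using M by (intro nn_integral_mono ennreal_leI)
        (auto simp: space_borel_probs[OF \<pi>] intro: max.coboundedI1)
    then show ?thesis by (simp only: nn_integral_const emeasure_space_1 mult_1_right)
  qed
  then show ?thesis by (intro exI[of _ "max M 0"]) auto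
qed

lemma negative_part_bounded:
  assumes b: "b \<in> B"
  shows "\<exists>M\<ge>0. \<forall>\<pi>\<in>borel_probs A. (\<integral>\<^sup>+a. ennreal (- min (c a b) 0) \<partial>\<pi>) \<le> ennreal M"
proof -
  obtain M where M: "\<And>a. a \<in> A \<Longrightarrow> M \<le> c a b"
    using payoff_bdd_below[OF b] by (auto simp: bdd_below_def)
  have "(\<integral>\<^sup>+a. ennreal (- min (c a b) 0) \<partial>\<pi>) \<le> ennreal (- min M 0)" if \<pi>: "\<pi> \<in> borel_probs A" for \<pi>
  proof -
    interpret prob_space \<pi> using \<pi> by (simp add: borel_probs_iff)
    have "(\<integral>\<^sup>+a. ennreal (- min (c a b) 0) \<partial>\<pi>) \<le> (\<integral>\<^sup>+a. ennreal (- min M 0) \<partial>\<pi>)"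
      using M by (intro nn_integral_mono ennreal_leI)
        (auto simp: space_borel_probs[OF \<pi>] intro: min.coboundedI1)
    then show ?thesis by (simp only: nn_integral_const emeasure_space_1 mult_1_right)
  qed
  then show ?thesis by (intro exI[of _ "- min M 0"]) auto
qed

lemma value_flat_less_infinity: "value_flat A B c < \<infinity>"
proof -
  obtain a where a: "a \<in> A" using A_nonempty by blast
  obtain M where M: "0 \<le> M" "\<And>\<pi>. \<pi> \<in> borel_probs B \<Longrightarrow>
      (\<integral>\<^sup>+b. ennreal (max (c a b) 0) \<partial>\<pi>) \<le> ennreal M"
    using positive_part_bounded[OF a] by blast
  have "payoff_flat A c \<pi> \<le> ereal M" if \<pi>: "\<pi> \<in> borel_probs B" for \<pi>
  proof -
    have "payoff_flat A c \<pi> \<le> extended_integral \<pi> (c a)"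
      unfolding payoff_flat_eq[OF \<pi>] using a by (rule INF_lower)
    also have "\<dots> \<le> enn2ereal (\<integral>\<^sup>+b. ennreal (max (c a b) 0) \<partial>\<pi>) + 0"
      unfolding extended_integral_def by (intro add_left_mono) simp
    also have "\<dots> \<le> enn2ereal (ennreal M)"
      using M(2)[OF \<pi>] by (simp only: less_eq_ennreal.rep_eq add_0_right)
    also have "\<dots> = ereal M" using M(1) by (rule enn2ereal_ennreal)
    finally show ?thesis .
  qed
  then have "value_flat A B c \<le> ereal M"
    unfolding value_flat_def by (intro SUP_least) (auto simp: sensible_II_def)
  then show ?thesis by (rule order_le_less_trans) simp
qed

text \<open>Suppose there are reals \<open>U < L\<close> between the two sides. Let \<open>P\<close> and \<open>N\<close> be the double integrals of the
positive and negative parts. Integrating \<open>L \<le> c(a, \<pi>\<^sup>B)\<close> over \<open>a\<close> gives \<open>L + N \<le> P\<close>,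
integrating \<open>c(\<pi>\<^sup>A, b) \<le> U\<close> over \<open>b\<close> gives \<open>P \<le> N + U\<close> by Tonelli's theorem.
As \<open>\<pi>\<^sup>A\<close>
is sensible, one of \<open>P\<close> and \<open>N\<close> is finite; then both are, and \<open>L \<le> U\<close>, a contradiction.\<close>

lemma payoff_flat_le_payoff_sharp:
  assumes \<pi>A: "\<pi>A \<in> sensible_I A B c" and \<pi>B: "\<pi>B \<in> borel_probs B"
  shows "payoff_flat A c \<pi>B \<le> payoff_sharp B c \<pi>A"
proof (rule ccontr)
  assume "\<not> ?thesis"
  then have less: "payoff_sharp B c \<pi>A < payoff_flat A c \<pi>B" by simp
  obtain U where U: "payoff_sharp B c \<pi>A < ereal U" "ereal U < payoff_flat A c \<pi>B"
    using ereal_dense2[OF less] by blast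
  obtain L where L: "ereal U < ereal L" "ereal L < payoff_flat A c \<pi>B"
    using ereal_dense2[OF U(2)] by blast
  have \<pi>A': "\<pi>A \<in> borel_probs A" using \<pi>A by (simp add: sensible_I_def)
  interpret A: prob_space \<pi>A using \<pi>A' by (simp add: borel_probs_iff)
  interpret B: prob_space \<pi>B using \<pi>B by (simp add: borel_probs_iff)
  interpret AB: pair_sigma_finite \<pi>A \<pi>B by unfold_locales
  note [measurable] = payoff_jointly_measurable[OF \<pi>A' \<pi>B]
  let ?p = "\<lambda>a b. ennreal (max (c a b) 0)" and ?n = "\<lambda>a b. ennreal (- min (c a b) 0)"
  have pm[measurable]: "(\<lambda>(a, b). ?p a b) \<in> borel_measurable (\<pi>A \<Otimes>\<^sub>M \<pi>B)"
    and nm[measurable]: "(\<lambda>(a, b). ?n a b) \<in> borel_measurable (\<pi>A \<Otimes>\<^sub>M \<pi>B)"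
    using payoff_jointly_measurable[OF \<pi>A' \<pi>B] by (simp_all add: case_prod_beta')
  define P where "P = (\<integral>\<^sup>+a. (\<integral>\<^sup>+b. ?p a b \<partial>\<pi>B) \<partial>\<pi>A)"
  define N where "N = (\<integral>\<^sup>+a. (\<integral>\<^sup>+b. ?n a b \<partial>\<pi>B) \<partial>\<pi>A)"
  have defined: "P \<noteq> top \<or> N \<noteq> top"
  proof -
    have "payoff_defined c \<pi>A \<pi>B" using \<pi>A \<pi>B by (simp add: sensible_I_def)
    then show ?thesis
      unfolding payoff_defined_def payoff_pos_def payoff_neg_def P_def[symmetric] N_def[symmetric]
      by (auto simp: top_ennreal.rep_eq)
  qed
  have swap: "P = (\<integral>\<^sup>+b. (\<integral>\<^sup>+a. ?p a b \<partial>\<pi>A) \<partial>\<pi>B)" "N = (\<integral>\<^sup>+b. (\<integral>\<^sup>+a. ?n a b \<partial>\<pi>A) \<partial>\<pi>B)"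
    unfolding P_def N_def using AB.Fubini'[OF pm] AB.Fubini'[OF nm] by simp_all
  have bn[measurable]: "(\<lambda>a. \<integral>\<^sup>+b. ?p a b \<partial>\<pi>B) \<in> borel_measurable \<pi>A" "(\<lambda>a. \<integral>\<^sup>+b. ?n a b \<partial>\<pi>B) \<in> borel_measurable \<pi>A"
    using pm nm by (auto intro!: B.borel_measurable_nn_integral)
  have swm: "(\<lambda>(b, a). ?p a b) \<in> borel_measurable (\<pi>B \<Otimes>\<^sub>M \<pi>A)" "(\<lambda>(b, a). ?n a b) \<in> borel_measurable (\<pi>B \<Otimes>\<^sub>M \<pi>A)"
    using measurable_pair_swap[OF pm] measurable_pair_swap[OF nm] by (simp_all add: case_prod_beta')
  have an[measurable]: "(\<lambda>b. \<integral>\<^sup>+a. ?p a b \<partial>\<pi>A) \<in> borel_measurable \<pi>B" "(\<lambda>b. \<integral>\<^sup>+a. ?n a b \<partial>\<pi>A) \<in> borel_measurable \<pi>B"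
    using swm by (auto intro!: A.borel_measurable_nn_integral)
  have "ennreal (max L 0) + N = (\<integral>\<^sup>+a. ennreal (max L 0) + (\<integral>\<^sup>+b. ?n a b \<partial>\<pi>B) \<partial>\<pi>A)"
    by (subst nn_integral_add) (auto simp: N_def A.emeasure_space_1)
  also have "\<dots> \<le> (\<integral>\<^sup>+a. (\<integral>\<^sup>+b. ?p a b \<partial>\<pi>B) + ennreal (max (- L) 0) \<partial>\<pi>A)"
  proof (rule nn_integral_mono)
    fix a assume "a \<in> space \<pi>A"
    then have a: "a \<in> A" by (simp add: space_borel_probs[OF \<pi>A'])
    have "ereal L \<le> extended_integral \<pi>B (c a)"
      using L(2) a unfolding payoff_flat_eq[OF \<pi>B] by (meson INF_lower less_imp_le order_less_le_trans)
    moreover have "(\<integral>\<^sup>+b. ?p a b \<partial>\<pi>B) \<noteq> top"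
      using positive_part_bounded[OF a] \<pi>B neq_top_trans[OF ennreal_neq_top] by blast
    ultimately show "ennreal (max L 0) + (\<integral>\<^sup>+b. ?n a b \<partial>\<pi>B) \<le> (\<integral>\<^sup>+b. ?p a b \<partial>\<pi>B) + ennreal (max (- L) 0)"
      unfolding extended_integral_def by (rule le_difference_imp_add_le)
  qed
  also have "\<dots> = P + ennreal (max (- L) 0)"
    by (subst nn_integral_add) (auto simp: P_def A.emeasure_space_1)
  finally have ineqL: "ennreal (max L 0) + N \<le> P + ennreal (max (- L) 0)" .
  have "P + ennreal (max (- U) 0) = (\<integral>\<^sup>+b. (\<integral>\<^sup>+a. ?p a b \<partial>\<pi>A) + ennreal (max (- U) 0) \<partial>\<pi>B)"
    by (subst nn_integral_add) (auto simp: swap B.emeasure_space_1)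
  also have "\<dots> \<le> (\<integral>\<^sup>+b. (\<integral>\<^sup>+a. ?n a b \<partial>\<pi>A) + ennreal (max U 0) \<partial>\<pi>B)"
  proof (rule nn_integral_mono)
    fix b assume "b \<in> space \<pi>B"
    then have b: "b \<in> B" by (simp add: space_borel_probs[OF \<pi>B])
    have "extended_integral \<pi>A (\<lambda>a. c a b) \<le> ereal U"
      using U(1) b unfolding payoff_sharp_eq[OF \<pi>A'] by (meson SUP_upper less_imp_le order_le_less_trans)
    moreover have "(\<integral>\<^sup>+a. ?n a b \<partial>\<pi>A) \<noteq> top"
      using negative_part_bounded[OF b] \<pi>A' neq_top_trans[OF ennreal_neq_top] by blast
    ultimately show "(\<integral>\<^sup>+a. ?p a b \<partial>\<pi>A) + ennreal (max (- U) 0) \<le> (\<integral>\<^sup>+a. ?n a b \<partial>\<pi>A) + ennreal (max U 0)"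
      unfolding extended_integral_def by (rule difference_le_imp_add_le)
  qed
  also have "\<dots> = N + ennreal (max U 0)"
    by (subst nn_integral_add) (auto simp: swap B.emeasure_space_1)
  finally have ineqU: "P + ennreal (max (- U) 0) \<le> N + ennreal (max U 0)" .
  have "L \<le> U"
    using ineqL ineqU defined
    by (cases P; cases N) (auto simp: ennreal_plus[symmetric] max_def top_unique simp del: ennreal_plus split: if_splits)
  with L(1) show False by simp
qed

end

section \<open>Strategies with finite support\<close>

text \<open>The combination of point masses \<open>\<Sum>b\<in>F. p b * \<delta>\<^sub>b\<close>, transported from the finite set to the Borel sets of \<open>S\<close>.\<close>

definition finite_strategy :: "'b::topological_space set \<Rightarrow> 'b set \<Rightarrow> ('b \<Rightarrow> real) \<Rightarrow> 'b measure" where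
  "finite_strategy S F p = distr (point_measure F (\<lambda>b. ennreal (p b))) (restrict_space borel S) (\<lambda>b. b)"

lemma nn_integral_finite_strategy:
  assumes "finite F" "F \<subseteq> S" "g \<in> borel_measurable (restrict_space borel S)"
  shows "(\<integral>\<^sup>+b. g b \<partial>finite_strategy S F p) = (\<Sum>b\<in>F. ennreal (p b) * g b)"
  unfolding finite_strategy_def using assms
  by (subst nn_integral_distr) (auto simp: nn_integral_point_measure_finite space_restrict_space)

lemma finite_strategy_borel_probs:
  assumes "finite F" "F \<subseteq> S" "\<And>b. b \<in> F \<Longrightarrow> 0 \<le> p b" "sum p F = 1"
  shows "finite_strategy S F p \<in> borel_probs S"
proof -
  have "emeasure (finite_strategy S F p) S = (\<integral>\<^sup>+b. indicator S b \<partial>finite_strategy S F p)"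
    by (rule nn_integral_indicator[symmetric])
      (auto simp: finite_strategy_def sets_restrict_space)
  also have "\<dots> = (\<Sum>b\<in>F. ennreal (p b) * indicator S b)"
    using assms sets.top[of "restrict_space borel S"]
    by (intro nn_integral_finite_strategy) (auto simp: space_restrict_space)
  also have "\<dots> = (\<Sum>b\<in>F. ennreal (p b))" using assms(2) by (intro sum.cong) auto
  also have "\<dots> = 1" using assms by (simp add: sum_ennreal)
  finally show ?thesis
    unfolding borel_probs_iff
    by (auto intro!: prob_spaceI simp: finite_strategy_def space_restrict_space)
qed

lemma extended_integral_finite_strategy:
  assumes "finite F" "F \<subseteq> S" "\<And>b. b \<in> F \<Longrightarrow> 0 \<le> p b"
    and [measurable]: "g \<in> borel_measurable (restrict_space borel S)"
  shows "extended_integral (finite_strategy S F p) g = ereal (\<Sum>b\<in>F. p b * g b)"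
proof -
  have nn: "(\<integral>\<^sup>+b. ennreal (h b) \<partial>finite_strategy S F p) = ennreal (\<Sum>b\<in>F. p b * h b)"
    if "h \<in> borel_measurable (restrict_space borel S)" "\<And>b. 0 \<le> h b" for h
  proof -
    have "(\<integral>\<^sup>+b. ennreal (h b) \<partial>finite_strategy S F p) = (\<Sum>b\<in>F. ennreal (p b) * ennreal (h b))"
      using assms(1,2) that by (intro nn_integral_finite_strategy) auto
    also have "\<dots> = (\<Sum>b\<in>F. ennreal (p b * h b))"
      using assms(3) that by (intro sum.cong) (auto simp: ennreal_mult)
    also have "\<dots> = ennreal (\<Sum>b\<in>F. p b * h b)" using assms(3) that by (intro sum_ennreal) auto
    finally show ?thesis .
  qed
  have "extended_integral (finite_strategy S F p) g
     = enn2ereal (ennreal (\<Sum>b\<in>F. p b * max (g b) 0)) + - enn2ereal (ennreal (\<Sum>b\<in>F. p b * - min (g b) 0))"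
    unfolding extended_integral_def by (subst (1 2) nn) auto
  also have "\<dots> = ereal (\<Sum>b\<in>F. p b * max (g b) 0) + - ereal (\<Sum>b\<in>F. p b * - min (g b) 0)"
  proof -
    have "0 \<le> (\<Sum>b\<in>F. p b * max (g b) 0)" "0 \<le> (\<Sum>b\<in>F. p b * - min (g b) 0)"
      by (rule sum_nonneg, rule mult_nonneg_nonneg, simp add: assms(3), simp)+
    then show ?thesis by (simp only: enn2ereal_ennreal)
  qed
  also have "\<dots> = ereal (\<Sum>b\<in>F. p b * max (g b) 0 - p b * - min (g b) 0)"
    by (subst sum_subtractf) simp
  also have "(\<Sum>b\<in>F. p b * max (g b) 0 - p b * - min (g b) 0) = (\<Sum>b\<in>F. p b * g b)"
    by (intro sum.cong) (auto simp: max_def min_def)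
  finally show ?thesis .
qed

lemma extended_integral_dirac_on:
  assumes "x \<in> S" "g \<in> borel_measurable (restrict_space borel S)"
  shows "extended_integral (dirac_on S x) g = ereal (g x)"
proof -
  have "extended_integral (dirac_on S x) g = enn2ereal (ennreal (max (g x) 0)) + - enn2ereal (ennreal (- min (g x) 0))"
    unfolding extended_integral_def using assms by (subst (1 2) nn_integral_dirac_on) auto
  then show ?thesis
    by (subst (asm) (1 2) enn2ereal_ennreal) (auto simp: max_def min_def)
qed

context zero_sum_game
begin

lemma payoff_integral_gt_minf:
  assumes \<pi>: "\<pi> \<in> borel_probs A" and b: "b \<in> B"
  shows "extended_integral \<pi> (\<lambda>a. c a b) > -\<infinity>"
proof -
  obtain M where M: "\<And>a. a \<in> A \<Longrightarrow> M \<le> c a b"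
    using payoff_bdd_below[OF b] by (auto simp: bdd_below_def)
  show ?thesis
  proof (rule extended_integral_gt_minf)
    show "prob_space \<pi>" using \<pi> by (simp add: borel_probs_iff)
    show "(\<lambda>a. c a b) \<in> borel_measurable \<pi>"
      using payoff_slice_I[OF b] by (simp add: measurable_borel_probs[OF \<pi>])
    show "- max 0 (- M) \<le> c a b" if "a \<in> space \<pi>" for a
      using M[of a] that by (simp add: space_borel_probs[OF \<pi>])
  qed simp
qed

text \<open>On a finite set of points \<open>b\<close> the negative parts have bounds uniform in the strategy of Player I.\<close>

lemma finite_strategy_sensible:
  assumes F: "finite F" "F \<subseteq> B" and p: "\<And>b. b \<in> F \<Longrightarrow> 0 \<le> p b" "sum p F = 1"
  shows "finite_strategy B F p \<in> sensible_II A B c"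
proof -
  have "\<exists>M. \<forall>b\<in>F. 0 \<le> M b \<and> (\<forall>\<pi>\<in>borel_probs A. (\<integral>\<^sup>+a. ennreal (- min (c a b) 0) \<partial>\<pi>) \<le> ennreal (M b))"
    using negative_part_bounded F(2) by (intro bchoice) blast
  then obtain M where M: "\<And>b. b \<in> F \<Longrightarrow> 0 \<le> M b"
    "\<And>b \<pi>. \<lbrakk>b \<in> F; \<pi> \<in> borel_probs A\<rbrakk> \<Longrightarrow> (\<integral>\<^sup>+a. ennreal (- min (c a b) 0) \<partial>\<pi>) \<le> ennreal (M b)"
    by blast
  have "payoff_defined c \<pi> (finite_strategy B F p)" if \<pi>: "\<pi> \<in> borel_probs A" for \<pi>
  proof -
    have meas: "(\<lambda>a. ennreal (- min (c a b) 0)) \<in> borel_measurable \<pi>" if "b \<in> F" for b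
    proof -
      have [measurable]: "(\<lambda>a. c a b) \<in> borel_measurable \<pi>"
        using payoff_slice_I[of b] that F(2) by (auto simp: measurable_borel_probs[OF \<pi>])
      show ?thesis by measurable
    qed
    have "(\<integral>\<^sup>+a. (\<integral>\<^sup>+b. ennreal (- min (c a b) 0) \<partial>finite_strategy B F p) \<partial>\<pi>)
        = (\<integral>\<^sup>+a. (\<Sum>b\<in>F. ennreal (p b) * ennreal (- min (c a b) 0)) \<partial>\<pi>)"
    proof (rule nn_integral_cong)
      fix a assume "a \<in> space \<pi>"
      then have [measurable]: "c a \<in> borel_measurable (restrict_space borel B)"
        using payoff_slice_II by (simp add: space_borel_probs[OF \<pi>])
      show "(\<integral>\<^sup>+b. ennreal (- min (c a b) 0) \<partial>finite_strategy B F p)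
        = (\<Sum>b\<in>F. ennreal (p b) * ennreal (- min (c a b) 0))"
        using F by (intro nn_integral_finite_strategy) measurable
    qed
    also have "\<dots> = (\<Sum>b\<in>F. ennreal (p b) * (\<integral>\<^sup>+a. ennreal (- min (c a b) 0) \<partial>\<pi>))"
      using meas by (subst nn_integral_sum) (auto intro!: sum.cong nn_integral_cmult borel_measurable_times)
    also have "\<dots> \<le> (\<Sum>b\<in>F. ennreal (p b) * ennreal (M b))"
      using M \<pi> by (intro sum_mono mult_left_mono) auto
    also have "\<dots> < top" using F(1) by (simp add: ennreal_mult_less_top)
    finally show ?thesis
      unfolding payoff_defined_def payoff_neg_def by (simp add: less_ennreal.rep_eq top_ennreal.rep_eq)
  qed
  then show ?thesis
    using finite_strategy_borel_probs[OF F p] by (auto simp: sensible_II_def)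
qed

text \<open>If no strategy held Player II to \<open>t\<close> on \<open>F\<close>, the weights of the finite minimax theorem would form a sensible
strategy that guarantees \<open>t > v\<^sup>\<flat>\<close> against every point \<open>a\<close>. The theorem is applied on the set \<open>X\<close> of strategies
with finite payoffs on \<open>F\<close>, where these are real and affine under mixtures; \<open>X\<close> contains
the point masses, which is all that the conclusion needs.\<close>

lemma strategy_against_finitely_many:
  assumes lsc: "\<And>b. b \<in> B \<Longrightarrow> open_superlevels_on A (\<lambda>a. c a b)"
    and F: "finite F" "F \<noteq> {}" "F \<subseteq> B" and t: "value_flat A B c < ereal t"
  shows "\<exists>\<pi>\<in>borel_probs A. \<forall>b\<in>F. extended_integral \<pi> (\<lambda>a. c a b) \<le> ereal t"
proof (rule ccontr)
  assume neg: "\<not> ?thesis"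
  let ?E = "\<lambda>b \<pi>. extended_integral \<pi> (\<lambda>a. c a b)"
  define X where "X = {\<pi> \<in> borel_probs A. \<forall>b\<in>F. ?E b \<pi> < \<infinity>}"
  define f where "f b \<pi> = real_of_ereal (?E b \<pi>)" for b \<pi>
  have E: "?E b \<pi> = ereal (f b \<pi>)" if "b \<in> F" "\<pi> \<in> X" for b \<pi>
  proof -
    have \<pi>: "\<pi> \<in> borel_probs A" using that by (simp add: X_def)
    have "?E b \<pi> > -\<infinity>"
      using \<pi> that(1) F(3) by (intro payoff_integral_gt_minf) auto
    moreover have "?E b \<pi> < \<infinity>" using that by (simp add: X_def)
    ultimately show ?thesis unfolding f_def by (cases "?E b \<pi>") auto
  qed
  have "\<exists>p. (\<forall>b\<in>F. 0 \<le> p b) \<and> sum p F = 1 \<and> (\<forall>\<pi>\<in>X. t \<le> (\<Sum>b\<in>F. p b * f b \<pi>))"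
  proof (rule finite_minimax_convexlike[OF F(1,2)])
    fix \<mu> \<nu> and u :: real assume \<mu>: "\<mu> \<in> X" and \<nu>: "\<nu> \<in> X" and u: "0 \<le> u" "u \<le> 1"
    have mix: "mixture u \<mu> \<nu> \<in> borel_probs A"
      using convex_borel_probs[of A] \<mu> \<nu> u by (auto simp: convex_measures_def X_def)
    have Emix: "?E b (mixture u \<mu> \<nu>) = ereal (u * f b \<mu> + (1 - u) * f b \<nu>)" if "b \<in> F" for b
    proof -
      have "?E b (mixture u \<mu> \<nu>) = ereal u * ?E b \<mu> + ereal (1 - u) * ?E b \<nu>"
        using \<mu> \<nu> u that F(3) lsc payoff_bdd_below
        by (intro extended_integral_mixture[where S = A]) (auto simp: X_def)
      then show ?thesis using E that \<mu> \<nu> by simp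
    qed
    then have "mixture u \<mu> \<nu> \<in> X" using mix by (simp add: X_def)
    then show "\<exists>\<pi>\<in>X. \<forall>b\<in>F. f b \<pi> \<le> u * f b \<mu> + (1 - u) * f b \<nu>"
      using Emix by (intro bexI[of _ "mixture u \<mu> \<nu>"]) (auto simp: f_def)
  next
    fix \<pi> assume \<pi>: "\<pi> \<in> X"
    then obtain b where "b \<in> F" "ereal t < ?E b \<pi>" using neg by (auto simp: X_def not_le)
    then show "\<exists>b\<in>F. t \<le> f b \<pi>" using E[OF _ \<pi>] by (auto intro!: bexI[of _ b])
  qed
  then obtain p where p: "\<And>b. b \<in> F \<Longrightarrow> 0 \<le> p b" "sum p F = 1"
    "\<And>\<pi>. \<pi> \<in> X \<Longrightarrow> t \<le> (\<Sum>b\<in>F. p b * f b \<pi>)" by blast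
  define \<sigma> where "\<sigma> = finite_strategy B F p"
  have \<sigma>: "\<sigma> \<in> sensible_II A B c"
    unfolding \<sigma>_def using F p by (intro finite_strategy_sensible) auto
  then have \<sigma>': "\<sigma> \<in> borel_probs B" by (simp add: sensible_II_def)
  have "ereal t \<le> payoff_flat A c \<sigma>"
    unfolding payoff_flat_eq[OF \<sigma>']
  proof (rule INF_greatest)
    fix a assume a: "a \<in> A"
    have Ed: "?E b (dirac_on A a) = ereal (c a b)" if "b \<in> F" for b
      using a that F(3) payoff_slice_I by (intro extended_integral_dirac_on) auto
    then have "dirac_on A a \<in> X" using a dirac_on_borel_probs by (auto simp: X_def)
    from p(3)[OF this] have "t \<le> (\<Sum>b\<in>F. p b * c a b)" by (simp add: f_def Ed)
    also have "ereal (\<Sum>b\<in>F. p b * c a b) = extended_integral \<sigma> (c a)"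
      unfolding \<sigma>_def using F(1,3) p(1) payoff_slice_II[OF a]
      by (rule extended_integral_finite_strategy[symmetric])
    finally show "ereal t \<le> extended_integral \<sigma> (c a)" by simp
  qed
  also have "\<dots> \<le> value_flat A B c" unfolding value_flat_def using \<sigma> by (rule SUP_upper)
  finally show False using t by simp
qed

end

section \<open>Compactness in games with an inf-compact payoff\<close>

locale coercive_game = zero_sum_game A B c
  for A :: "'a::polish_space set" and B :: "'b::polish_space set" and c +
  assumes superlevels: "b \<in> B \<Longrightarrow> open_superlevels_on A (\<lambda>a. c a b)"
    and coercive: "\<exists>b0\<in>B. inf_compact_on A (\<lambda>a. ereal (c a b0))"
begin

lemma payoff_bound_imp_cluster_point:
  assumes F: "F \<noteq> bot" "eventually (\<lambda>\<pi>. \<pi> \<in> borel_probs A) F"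
    and bound: "\<And>b. b \<in> B \<Longrightarrow> \<exists>T. eventually (\<lambda>\<pi>. extended_integral \<pi> (\<lambda>a. c a b) \<le> ereal T) F"
  obtains G \<mu> where "G \<noteq> bot" "G \<le> F" "\<mu> \<in> borel_probs A" "liminf_on_opens A G \<mu>"
proof -
  obtain b where b: "b \<in> B" "inf_compact_on A (\<lambda>a. ereal (c a b))" using coercive by blast
  obtain T where T: "eventually (\<lambda>\<pi>. extended_integral \<pi> (\<lambda>a. c a b) \<le> ereal T) F"
    using bound[OF b(1)] by blast
  show thesis
    using coercive_bound_imp_cluster_point[OF A_borel superlevels[OF b(1)]
        payoff_bdd_below[OF b(1)] b(2) F T] that .
qed

text \<open>The filter \<open>F\<close> is generated by the constraints \<open>c(\<pi>, b) \<le> t\<close> over all \<open>b\<close> and all real \<open>t > v\<^sup>\<flat>\<close>. Finitely many of them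
follow from those with the least \<open>t\<close>, and a cluster point satisfies all of them.\<close>

lemma strategy_within_value_flat:
  "\<exists>\<pi>\<in>borel_probs A. \<forall>b\<in>B. extended_integral \<pi> (\<lambda>a. c a b) \<le> value_flat A B c"
proof -
  let ?E = "\<lambda>b \<pi>. extended_integral \<pi> (\<lambda>a. c a b)"
  define I where "I = B \<times> {t. value_flat A B c < ereal t}"
  define Z where "Z i = {\<pi> \<in> borel_probs A. ?E (fst i) \<pi> \<le> ereal (snd i)}" for i
  define F where "F = (INF i\<in>I. principal (Z i))"
  obtain t0 where t0: "value_flat A B c < ereal t0"
    using ereal_dense2[OF value_flat_less_infinity] by blast
  have "F \<noteq> bot"
    unfolding F_def
  proof (rule INF_filter_not_bot)
    fix X assume X: "X \<subseteq> I" "finite X"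
    show "(INF i\<in>X. principal (Z i)) \<noteq> bot"
    proof (cases "X = {}")
      case True
      then show ?thesis by (simp add: trivial_limit_def)
    next
      case False
      define t where "t = Min (snd ` X)"
      have "t \<in> snd ` X" using X False by (simp add: t_def)
      then have t: "value_flat A B c < ereal t" using X(1) by (auto simp: I_def)
      have "\<exists>\<pi>\<in>borel_probs A. \<forall>b\<in>fst ` X. ?E b \<pi> \<le> ereal t"
        using X False by (intro strategy_against_finitely_many superlevels t) (auto simp: I_def)
      then obtain \<pi> where \<pi>: "\<pi> \<in> borel_probs A" "\<And>i. i \<in> X \<Longrightarrow> ?E (fst i) \<pi> \<le> ereal t" by blast
      have "\<pi> \<in> Z i" if i: "i \<in> X" for i
      proof -
        have "t \<le> snd i" using X(2) i by (simp add: t_def)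
        then have "?E (fst i) \<pi> \<le> ereal (snd i)" using \<pi>(2)[OF i] by (meson ereal_less_eq(3) order_trans)
        then show ?thesis using \<pi>(1) by (simp add: Z_def)
      qed
      then have "(\<Inter>i\<in>X. Z i) \<noteq> {}" by blast
      then show ?thesis
        unfolding INF_principal_finite[OF X(2)] by (simp add: principal_eq_bot_iff)
    qed
  qed
  moreover have ev: "eventually (\<lambda>\<pi>. \<pi> \<in> Z i) F" if "i \<in> I" for i
    unfolding F_def using that by (intro eventually_INF1) (auto simp: eventually_principal)
  moreover have "eventually (\<lambda>\<pi>. \<pi> \<in> borel_probs A) F"
  proof -
    obtain b0 where "b0 \<in> B" using B_nonempty by blast
    then have "eventually (\<lambda>\<pi>. \<pi> \<in> Z (b0, t0)) F" using t0 by (intro ev) (simp add: I_def)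
    then show ?thesis by eventually_elim (simp add: Z_def)
  qed
  moreover have bound: "eventually (\<lambda>\<pi>. ?E b \<pi> \<le> ereal t) F" if "b \<in> B" "value_flat A B c < ereal t" for b t
    using ev[of "(b, t)"] that by (auto simp: I_def Z_def elim: eventually_mono)
  ultimately obtain G \<mu> where G: "G \<noteq> bot" "G \<le> F" and \<mu>: "\<mu> \<in> borel_probs A"
    and lim: "liminf_on_opens A G \<mu>"
    using payoff_bound_imp_cluster_point t0 by metis
  have probs: "eventually (\<lambda>\<pi>. \<pi> \<in> borel_probs A) G"
    using G(2) \<open>eventually (\<lambda>\<pi>. \<pi> \<in> borel_probs A) F\<close> by (rule filter_leD)
  have "?E b \<mu> \<le> value_flat A B c" if b: "b \<in> B" for b
  proof (rule dense_ge)
    fix r assume "value_flat A B c < r"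
    then obtain t where t: "value_flat A B c < ereal t" "ereal t < r" using ereal_dense2 by blast
    have "?E b \<mu> \<le> ereal t"
      using filter_leD[OF G(2) bound[OF b t(1)]]
      by (intro extended_integral_le_on_limit[OF G(1) probs \<mu> lim superlevels[OF b] payoff_bdd_below[OF b]])
    then show "?E b \<mu> \<le> r" using t(2) by simp
  qed
  with \<mu> show ?thesis by blast
qed

lemma sharp_sublevel_eq:
  "sharp_sublevel A B c r = {\<pi> \<in> borel_probs A. \<forall>b\<in>B. extended_integral \<pi> (\<lambda>a. c a b) \<le> r}"
  unfolding sharp_sublevel_def by (auto simp: payoff_sharp_eq SUP_le_iff)

lemma sharp_sublevel_convex:
  "convex_measures (sharp_sublevel A B c (ereal r))"
  unfolding convex_measures_def
proof (intro ballI)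
  fix \<mu> \<nu> and t :: real
  assume \<mu>: "\<mu> \<in> sharp_sublevel A B c (ereal r)" and \<nu>: "\<nu> \<in> sharp_sublevel A B c (ereal r)" and t: "t \<in> {0..1}"
  have "extended_integral (mixture t \<mu> \<nu>) (\<lambda>a. c a b) \<le> ereal r" if b: "b \<in> B" for b
  proof -
    have "extended_integral (mixture t \<mu> \<nu>) (\<lambda>a. c a b)
      = ereal t * extended_integral \<mu> (\<lambda>a. c a b) + ereal (1 - t) * extended_integral \<nu> (\<lambda>a. c a b)"
      using \<mu> \<nu> t b superlevels payoff_bdd_below
      by (intro extended_integral_mixture[where S = A]) (auto simp: sharp_sublevel_eq)
    also have "\<dots> \<le> ereal t * ereal r + ereal (1 - t) * ereal r"
      using \<mu> \<nu> t b by (intro add_mono ereal_mult_left_mono) (auto simp: sharp_sublevel_eq)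
    also have "\<dots> = ereal r" by (simp add: algebra_simps)
    finally show ?thesis .
  qed
  moreover have "mixture t \<mu> \<nu> \<in> borel_probs A"
    using convex_borel_probs[of A] \<mu> \<nu> t by (auto simp: convex_measures_def sharp_sublevel_eq)
  ultimately show "mixture t \<mu> \<nu> \<in> sharp_sublevel A B c (ereal r)" by (simp add: sharp_sublevel_eq)
qed

text \<open>A family of closed sets with the finite intersection property generates a filter. Its cluster point
stays in the sublevel set by lower semicontinuity, and in each closed set because the complement would be
a weak neighbourhood.\<close>

lemma sharp_sublevel_compact:
  "compactin (weak_topology A) (sharp_sublevel A B c (ereal r))"
  unfolding compactin_fip
proof (intro conjI allI impI)
  let ?S = "sharp_sublevel A B c (ereal r)"
  show "?S \<subseteq> topspace (weak_topology A)"
    by (auto simp: sharp_sublevel_eq topspace_weak_topology)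
  fix \<C> assume "(\<forall>C\<in>\<C>. closedin (weak_topology A) C) \<and> (\<forall>\<F>. finite \<F> \<and> \<F> \<subseteq> \<C> \<longrightarrow> ?S \<inter> \<Inter>\<F> \<noteq> {})"
  then have closed: "\<And>C. C \<in> \<C> \<Longrightarrow> closedin (weak_topology A) C"
    and fip: "\<And>\<F>. \<lbrakk>finite \<F>; \<F> \<subseteq> \<C>\<rbrakk> \<Longrightarrow> ?S \<inter> \<Inter>\<F> \<noteq> {}" by auto
  define F where "F = (INF C\<in>insert UNIV \<C>. principal (?S \<inter> C))"
  have "F \<noteq> bot"
    unfolding F_def
  proof (rule INF_filter_not_bot)
    fix X assume X: "X \<subseteq> insert UNIV \<C>" "finite X"
    then have "?S \<inter> \<Inter>(X - {UNIV}) \<noteq> {}" by (intro fip) auto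
    then have "(\<Inter>C\<in>X. ?S \<inter> C) \<noteq> {}" by blast
    then show "(INF C\<in>X. principal (?S \<inter> C)) \<noteq> bot"
      unfolding INF_principal_finite[OF X(2)] by (simp add: principal_eq_bot_iff)
  qed
  have ev: "eventually (\<lambda>\<pi>. \<pi> \<in> ?S \<inter> C) F" if "C \<in> insert UNIV \<C>" for C
    unfolding F_def using that by (intro eventually_INF1) (auto simp: eventually_principal)
  have inS: "eventually (\<lambda>\<pi>. \<pi> \<in> ?S) F" using ev[of UNIV] by simp
  have probsF: "eventually (\<lambda>\<pi>. \<pi> \<in> borel_probs A) F"
    using inS by eventually_elim (simp add: sharp_sublevel_eq)
  have bound: "eventually (\<lambda>\<pi>. extended_integral \<pi> (\<lambda>a. c a b) \<le> ereal r) F" if "b \<in> B" for b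
    using inS by eventually_elim (simp add: sharp_sublevel_eq that)
  obtain G \<mu> where G: "G \<noteq> bot" "G \<le> F" and \<mu>: "\<mu> \<in> borel_probs A"
    and lim: "liminf_on_opens A G \<mu>"
    using payoff_bound_imp_cluster_point[OF \<open>F \<noteq> bot\<close> probsF] bound by blast
  have probs: "eventually (\<lambda>\<pi>. \<pi> \<in> borel_probs A) G" using G(2) probsF by (rule filter_leD)
  have "extended_integral \<mu> (\<lambda>a. c a b) \<le> ereal r" if b: "b \<in> B" for b
    using filter_leD[OF G(2) bound[OF b]]
    by (intro extended_integral_le_on_limit[OF G(1) probs \<mu> lim superlevels[OF b] payoff_bdd_below[OF b]])
  with \<mu> have "\<mu> \<in> ?S" by (simp add: sharp_sublevel_eq)
  moreover have "\<mu> \<in> C" if C: "C \<in> \<C>" for C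
  proof (rule ccontr)
    assume "\<mu> \<notin> C"
    then have "eventually (\<lambda>\<pi>. \<pi> \<in> topspace (weak_topology A) - C) G"
      using openin_diff[OF openin_topspace closed[OF C]] \<mu>
      by (intro eventually_in_weak_open[OF probs \<mu> lim]) (auto simp: topspace_weak_topology)
    moreover have "eventually (\<lambda>\<pi>. \<pi> \<in> ?S \<inter> C) G" using C by (intro filter_leD[OF G(2)] ev) auto
    ultimately have "eventually (\<lambda>_. False) G" by eventually_elim auto
    with G(1) show False by (simp add: trivial_limit_def)
  qed
  ultimately show "?S \<inter> \<Inter>\<C> \<noteq> {}" by blast
qed

end

section \<open>The value of the game and the solutions of Player I\<close>

theorem theorem3p4:
  fixes A :: "'a::polish_space set" and B :: "'b::polish_space set"
    and c :: "'a \<Rightarrow> 'b \<Rightarrow> real"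
  assumes game: "zero_sum_game A B c"
    and a1: "\<forall>b\<in>B. lower_semicontinuous_on A (\<lambda>a. ereal (c a b))"
    and a2: "\<exists>b0\<in>B. inf_compact_on A (\<lambda>a. ereal (c a b0))"
    and unsensible: "\<forall>\<pi>A \<in> unsensible_I A B c. payoff_sharp B c \<pi>A \<ge> value_sharp A B c"
  shows "\<exists>v. has_game_value A B c v
    \<and> v = (SUP \<pi>B \<in> borel_probs B. payoff_flat A c \<pi>B)
    \<and> v = (INF \<pi>A \<in> borel_probs A. payoff_sharp B c \<pi>A)
    \<and> ((\<forall>\<pi>A \<in> unsensible_I A B c. payoff_sharp B c \<pi>A > value_sharp A B c) \<longrightarrow>
          sharp_sublevel A B c v \<subseteq> sensible_I A B c
        \<and> sharp_sublevel A B c v = solutions_I A B c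
        \<and> sharp_sublevel A B c v \<noteq> {}
        \<and> convex_measures (sharp_sublevel A B c v)
        \<and> compactin (weak_topology A) (sharp_sublevel A B c v))"
proof -
  interpret zero_sum_game A B c by (rule game)
  interpret coercive_game A B c
    by standard (use a1 a2 in \<open>auto intro!: lower_semicontinuous_imp_open_superlevels\<close>)
  let ?v = "value_flat A B c" and ?w = "value_sharp A B c"
  have sharp_ge: "?w \<le> payoff_sharp B c \<pi>" if "\<pi> \<in> borel_probs A" for \<pi>
  proof (cases "\<pi> \<in> sensible_I A B c")
    case True
    then show ?thesis unfolding value_sharp_def by (rule INF_lower)
  next
    case False
    with that show ?thesis using unsensible by (auto simp: unsensible_I_def)
  qed
  have flat_le: "payoff_flat A c \<sigma> \<le> ?w" if "\<sigma> \<in> borel_probs B" for \<sigma>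
    unfolding value_sharp_def using that by (intro INF_greatest payoff_flat_le_payoff_sharp)
  obtain \<pi>0 where \<pi>0: "\<pi>0 \<in> borel_probs A" "payoff_sharp B c \<pi>0 \<le> ?v"
    using strategy_within_value_flat by (auto simp: payoff_sharp_eq SUP_le_iff)
  have "?v \<le> ?w"
    unfolding value_flat_def by (intro SUP_least flat_le) (auto simp: sensible_II_def)
  moreover have "?w \<le> ?v" using sharp_ge[OF \<pi>0(1)] \<pi>0(2) by simp
  ultimately have vw: "?w = ?v" by simp
  obtain r where r: "?v = ereal r"
  proof -
    have "-\<infinity> < ?v"
    proof -
      obtain b where b: "b \<in> B" using B_nonempty by blast
      have "-\<infinity> < extended_integral \<pi>0 (\<lambda>a. c a b)" using \<pi>0(1) b by (rule payoff_integral_gt_minf)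
      also have "\<dots> \<le> payoff_sharp B c \<pi>0"
        unfolding payoff_sharp_eq[OF \<pi>0(1)] using b by (rule SUP_upper)
      also note \<pi>0(2)
      finally show ?thesis .
    qed
    then show thesis using that value_flat_less_infinity by (cases ?v) auto
  qed
  have sup: "?v = (SUP \<sigma>\<in>borel_probs B. payoff_flat A c \<sigma>)"
  proof (rule antisym)
    show "?v \<le> (SUP \<sigma>\<in>borel_probs B. payoff_flat A c \<sigma>)"
      unfolding value_flat_def by (rule SUP_subset_mono) (auto simp: sensible_II_def)
    show "(SUP \<sigma>\<in>borel_probs B. payoff_flat A c \<sigma>) \<le> ?v"
      using flat_le vw by (intro SUP_least) auto
  qed
  have inf: "?v = (INF \<pi>\<in>borel_probs A. payoff_sharp B c \<pi>)"
  proof (rule antisym)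
    show "?v \<le> (INF \<pi>\<in>borel_probs A. payoff_sharp B c \<pi>)"
      using sharp_ge vw by (intro INF_greatest) auto
    show "(INF \<pi>\<in>borel_probs A. payoff_sharp B c \<pi>) \<le> ?v"
      using \<pi>0 by (rule INF_lower2)
  qed
  have last: "sharp_sublevel A B c ?v \<subseteq> sensible_I A B c \<and> sharp_sublevel A B c ?v = solutions_I A B c"
    if strict: "\<forall>\<pi> \<in> unsensible_I A B c. payoff_sharp B c \<pi> > ?w"
  proof -
    have sub: "sharp_sublevel A B c ?v \<subseteq> sensible_I A B c"
    proof
      fix \<pi> assume \<pi>: "\<pi> \<in> sharp_sublevel A B c ?v"
      show "\<pi> \<in> sensible_I A B c"
      proof (rule ccontr)
        assume "\<pi> \<notin> sensible_I A B c"
        then have "?w < payoff_sharp B c \<pi>"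
          using \<pi> strict by (simp add: unsensible_I_def sharp_sublevel_def)
        moreover have "payoff_sharp B c \<pi> \<le> ?w" using \<pi> vw by (simp add: sharp_sublevel_def)
        ultimately show False by simp
      qed
    qed
    moreover have "payoff_sharp B c \<pi> = ?w" if "\<pi> \<in> sharp_sublevel A B c ?v" for \<pi>
      using that sharp_ge[of \<pi>] vw by (auto simp: sharp_sublevel_def intro: antisym)
    ultimately have "sharp_sublevel A B c ?v \<subseteq> solutions_I A B c"
      unfolding solutions_I_def by blast
    moreover have "solutions_I A B c \<subseteq> sharp_sublevel A B c ?v"
      unfolding solutions_I_def sharp_sublevel_def sensible_I_def vw by auto
    ultimately show ?thesis using sub by blast
  qed
  have "sharp_sublevel A B c ?v \<noteq> {}" using \<pi>0 by (auto simp: sharp_sublevel_def)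
  with last sharp_sublevel_convex[of r] sharp_sublevel_compact[of r] show ?thesis
    using vw sup inf unfolding r[symmetric] by (intro exI[of _ ?v]) (auto simp: has_game_value_def)
qed

end
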